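(* If $\lambda=\mu$, then for all $t>0$ $$p(0,t)=\frac{2\binom{2N}{N}}{\binom{2N}{N}+4^N}+2\sum_{k=2}^{N+1}R(\alpha_k)\left[e^{-(\xi-\alpha_k)t}+\frac{\xi}{\xi-\alpha_k}\left(1-e^{-(\xi-\alpha_k)t}\right)\right].$$ Moreover, for $r=1,2,\dots,N$, $$\begin{aligned}p(r,t)={}&\frac1{4^N}\binom{2N}{N+r}\sum_{l=0}^N\binom Nl(-1)^l\theta_1(2l,0,0)\left[1-\theta_2(t,4l\mu)\right]\\ &+\frac{\mu N}{2^{2N-2}}(-1)^{N-r}\sum_{j=0}^{N-1}\binom{N-1}{j}(-1)^{N-1-j}\left\{\binom{2N-1}{N+r}\theta_1(2j,1,1)-\binom{2N-1}{N+r-1}\theta_1(2j,0,1)\right\}\\ &\qquad\times\sum_{k=1}^{N+1}\frac{R(\alpha_k)}{|\alpha_k|-2\mu(2N-2j-1)}\left\{\theta_2\big(t,2\mu(2N-2j-1)\big)-\theta_2(t,|\alpha_k|)\right\}\\ &+\frac{\mu N}{2^{2N-2}}(-1)^{N-r}\binom{2N}{N+r}\sum_{j=0}^{N-1}\binom{N-1}{j}(-1)^{N-1-j}\theta_1(2j,0,0)\\ &\qquad\times\sum_{k=1}^{N+1}\frac{R(\alpha_k)}{|\alpha_k|-4\mu(N-j)}\left\{\theta_2\big(t,4\mu(N-j)\big)-\theta_2(t,|\alpha_k|)\right\}.\end{aligned}$$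
   Context: Let $N,d$ be positive integers, $D=\{1,\dots,d\}$, $\lambda,\mu,\xi>0$, and let $\mathbf C=(c_{l,j})_{l,j\in D}$ be an irreducible stochastic matrix. The process $\mathbf X_t=(\mathcal N(t),J(t))$, $t\ge 0$, is the continuous-time Markov chain on $\{0,1,\dots,N\}\times D$ (first coordinate: level; second coordinate: phase) started at $(0,l_0)$ for some $l_0\in D$, with the following transition rates: from $(0,l)$ to $(1,j)$ at rate $c_{l,j}\lambda N$ for $l,j\in D$; from $(k,j)$ to $(k+1,j)$ at rate $\lambda(N-k)$ for $1\le k\le N-1$; from $(k,j)$ to $(k-1,j)$ at rate $\mu(N+k)$ for $1\le k\le N$; and, in addition, from $(k,j)$ to $(0,j)$ at rate $\xi$ for $1\le k\le N$ (catastrophe; for $k=1$ the total rate from $(1,j)$ to $(0,j)$ is $\mu(N+1)+\xi$). No other transitions occur. Write $p(k,j,t)=P\{(\mathcal N(t),J(t))=(k,j)\mid(\mathcal N(0),J(0))=(0,l_0)\}$ and $p(k,t)=\sum_{j\in D}p(k,j,t)$. The numbers $0=\alpha_1>\alpha_2>\dots>\alpha_{N+1}$ are the roots (known to be real and distinct) of the polynomial $$P(x)=x\left[\prod_{r=0}^{N-1}\big(x+2\mu(2r+1)\big)+\prod_{r=0}^{N-1}\big(x+2\mu(2r+2)\big)\right],$$ and for $k=1,\dots,N+1$ $$R(\alpha_k)=\frac{\prod_{r=0}^{N-1}\left[\alpha_k+2\mu(2r+1)\right]}{2\prod_{s=1,\,s\ne k}^{N+1}(\alpha_k-\alpha_s)}.$$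 For given $r$, set $\theta_1(a,b,c)={}_2F_1(-a,-N+r+b;-2N+c;2)$, the Gauss hypergeometric function, which for a nonnegative integer $a$ is the terminating sum $\sum_{i=0}^{a}\frac{(-a)_i(-N+r+b)_i}{(-2N+c)_i\,i!}2^i$, with $(x)_i=x(x+1)\cdots(x+i-1)$; and $\theta_2(t,y)=\left(1-e^{-t(\xi+y)}\right)\left(1-\frac{\xi}{\xi+y}\right)$. Binomial coefficients $\binom{m}{n}$ with $n>m\ge0$ are $0$. *)

theory Defs
  imports "HOL-Probability.Probability" "HOL-Computational_Algebra.Polynomial"
begin

definition stochastic_matrix_on :: "'s set \<Rightarrow> ('s \<Rightarrow> 's \<Rightarrow> real) \<Rightarrow> bool" where
  "stochastic_matrix_on S c \<longleftrightarrow>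
     (\<forall>x\<in>S. \<forall>y\<in>S. 0 \<le> c x y) \<and> (\<forall>x\<in>S. (\<Sum>y\<in>S. c x y) = 1)"

text \<open>Irreducibility of a nonnegative matrix: every index leads to every index along a
  finite chain of positive entries.\<close>

definition irreducible_matrix_on :: "'s set \<Rightarrow> ('s \<Rightarrow> 's \<Rightarrow> real) \<Rightarrow> bool" where
  "irreducible_matrix_on S c \<longleftrightarrow>
     (\<forall>x\<in>S. \<forall>y\<in>S. (x, y) \<in> {(a, b). a \<in> S \<and> b \<in> S \<and> 0 < c a b}\<^sup>+)"

text \<open>A transition function on the finite state space \<open>S\<close> with transition rates \<open>q x y\<close>
  for \<open>x \<noteq> y\<close>. The diagonal of \<open>q\<close> is never consulted: since the rows of \<open>Pt h\<close> sum to one, the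
  derivative of \<open>Pt h x x\<close> at \<open>h = 0\<close> is minus the sum of the rates out of \<open>x\<close>.\<close>

definition transition_function ::
  "'s set \<Rightarrow> ('s \<Rightarrow> 's \<Rightarrow> real) \<Rightarrow> (real \<Rightarrow> 's \<Rightarrow> 's \<Rightarrow> real) \<Rightarrow> bool" where
  "transition_function S q Pt \<longleftrightarrow>
     (\<forall>t\<ge>0. stochastic_matrix_on S (Pt t)) \<and>
     (\<forall>x\<in>S. \<forall>y\<in>S. Pt 0 x y = (if x = y then 1 else 0)) \<and>
     (\<forall>s\<ge>0. \<forall>t\<ge>0. \<forall>x\<in>S. \<forall>y\<in>S. Pt (s + t) x y = (\<Sum>z\<in>S. Pt s x z * Pt t z y)) \<and>
     (\<forall>x\<in>S. \<forall>y\<in>S. x \<noteq> y \<longrightarrow> ((\<lambda>h. Pt h x y / h) \<longlongrightarrow> q x y) (at_right 0))"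

text \<open>\<open>X\<close> is a time-homogeneous continuous-time Markov chain on the probability space \<open>M\<close> with
  finite state space \<open>S\<close> and transition rates \<open>q\<close>. No path regularity is required.\<close>

definition markov_chain_with_rates ::
  "'a measure \<Rightarrow> 's set \<Rightarrow> ('s \<Rightarrow> 's \<Rightarrow> real) \<Rightarrow> (real \<Rightarrow> 'a \<Rightarrow> 's) \<Rightarrow> bool" where
  "markov_chain_with_rates M S q X \<longleftrightarrow>
     prob_space M \<and> finite S \<and>
     (\<forall>t\<ge>0. X t \<in> M \<rightarrow>\<^sub>M count_space S) \<and>
     (\<exists>Pt. transition_function S q Pt \<and>
       (\<forall>(n::nat) (\<tau>::nat \<Rightarrow> real) (x::nat \<Rightarrow> 's).
          0 \<le> \<tau> 0 \<and> (\<forall>i\<le>n. \<tau> i < \<tau> (Suc i)) \<and> (\<forall>i\<le>Suc n. x i \<in> S) \<and>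
          \<P>(\<omega> in M. \<forall>i\<le>n. X (\<tau> i) \<omega> = x i) > 0 \<longrightarrow>
          \<P>(\<omega> in M. X (\<tau> (Suc n)) \<omega> = x (Suc n) \<bar> \<forall>i\<le>n. X (\<tau> i) \<omega> = x i)
            = Pt (\<tau> (Suc n) - \<tau> n) (x n) (x (Suc n))))"

text \<open>States are pairs (level, phase).\<close>

abbreviation states :: "nat \<Rightarrow> nat \<Rightarrow> (nat \<times> nat) set" where
  "states N d \<equiv> {0..N} \<times> {1..d}"

text \<open>The summands are, in order: leaving level 0, upward steps, downward steps, catastrophes.
  For a jump from level 1 to level 0 the last two add up.\<close>

definition rates ::
  "nat \<Rightarrow> (nat \<Rightarrow> nat \<Rightarrow> real) \<Rightarrow> real \<Rightarrow> real \<Rightarrow> real \<Rightarrow> nat \<times> nat \<Rightarrow> nat \<times> nat \<Rightarrow> real" where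
  "rates N c lam mu xi = (\<lambda>(k, l) (k', j).
      (if k = 0 \<and> k' = 1 then c l j * lam * real N else 0)
    + (if 1 \<le> k \<and> k \<le> N - 1 \<and> k' = k + 1 \<and> j = l then lam * (real N - real k) else 0)
    + (if 1 \<le> k \<and> k \<le> N \<and> k' = k - 1 \<and> j = l then mu * (real N + real k) else 0)
    + (if 1 \<le> k \<and> k \<le> N \<and> k' = 0 \<and> j = l then xi else 0))"

definition p_joint ::
  "'a measure \<Rightarrow> (real \<Rightarrow> 'a \<Rightarrow> nat \<times> nat) \<Rightarrow> nat \<Rightarrow> nat \<Rightarrow> nat \<Rightarrow> real \<Rightarrow> real" where
  "p_joint M X l0 k j t = \<P>(\<omega> in M. X t \<omega> = (k, j) \<bar> X 0 \<omega> = (0, l0))"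

definition p_level ::
  "'a measure \<Rightarrow> (real \<Rightarrow> 'a \<Rightarrow> nat \<times> nat) \<Rightarrow> nat \<Rightarrow> nat \<Rightarrow> nat \<Rightarrow> real \<Rightarrow> real" where
  "p_level M X d l0 k t = (\<Sum>j\<in>{1..d}. p_joint M X l0 k j t)"

definition char_poly_P :: "nat \<Rightarrow> real \<Rightarrow> real poly" where
  "char_poly_P N mu = [:0, 1:] *
     ((\<Prod>r<N. [:2 * mu * (2 * real r + 1), 1:]) + (\<Prod>r<N. [:2 * mu * (2 * real r + 2), 1:]))"

text \<open>\<open>\<alpha> 1 > \<dots> > \<alpha> (N + 1)\<close> lists all roots; values of \<open>\<alpha>\<close> at other indices are irrelevant.\<close>

definition enumerates_roots :: "nat \<Rightarrow> real \<Rightarrow> (nat \<Rightarrow> real) \<Rightarrow> bool" where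
  "enumerates_roots N mu \<alpha> \<longleftrightarrow>
     \<alpha> 1 = 0 \<and>
     (\<forall>i\<in>{1..N+1}. \<forall>j\<in>{1..N+1}. i < j \<longrightarrow> \<alpha> j < \<alpha> i) \<and>
     \<alpha> ` {1..N+1} = {x. poly (char_poly_P N mu) x = 0}"

definition R_coeff :: "nat \<Rightarrow> real \<Rightarrow> (nat \<Rightarrow> real) \<Rightarrow> nat \<Rightarrow> real" where
  "R_coeff N mu \<alpha> k =
     (\<Prod>r<N. \<alpha> k + 2 * mu * (2 * real r + 1)) /
     (2 * (\<Prod>s\<in>{1..N+1} - {k}. \<alpha> k - \<alpha> s))"

text \<open>The Gauss hypergeometric function \<open>\<^sub>2F\<^sub>1(-a, -N+r+b; -2N+c; 2)\<close>, which terminates since \<open>a\<close>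
  is a natural number.\<close>

definition theta1 :: "nat \<Rightarrow> nat \<Rightarrow> nat \<Rightarrow> real \<Rightarrow> real \<Rightarrow> real" where
  "theta1 N r a b c =
     (\<Sum>i=0..a. pochhammer (- real a) i * pochhammer (- real N + real r + b) i /
        (pochhammer (- 2 * real N + c) i * fact i) * 2 ^ i)"

definition theta2 :: "real \<Rightarrow> real \<Rightarrow> real \<Rightarrow> real" where
  "theta2 xi t y = (1 - exp (- t * (xi + y))) * (1 - xi / (xi + y))"

text \<open>The roots are indeed real and distinct, so \<open>enumerates_roots\<close> is satisfiable; the
  nonzero roots interlace with the points \<open>-2\<mu>, -4\<mu>, \<dots>, -4N\<mu>\<close>.\<close>

lemma prod_sign:
  fixes mu :: real
  assumes "mu > 0" "i \<le> N"
  shows "(-1) ^ i * (\<Prod>r<N. 2 * mu * (2 * real r + 1 - 2 * real i)) > 0"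
proof -
  have "(\<Prod>r<N. if r < i then -1 else 1 :: real) = (\<Prod>r\<in>{..<i}. -1)"
    using assms(2) by (intro prod.mono_neutral_cong_right) auto
  then have e: "(-1) ^ i = (\<Prod>r<N. if r < i then -1 else 1 :: real)" by simp
  have "0 < (\<Prod>r<N. (if r < i then -1 else 1) * (2 * mu * (2 * real r + 1 - 2 * real i)))"
  proof (rule prod_pos)
    fix r assume "r \<in> {..<N}"
    show "0 < (if r < i then -1 else 1) * (2 * mu * (2 * real r + 1 - 2 * real i))"
    proof (cases "r < i")
      case True
      then have "real r + 1 \<le> real i" by linarith
      then have "2 * real r + 1 - 2 * real i < 0" by linarith
      with True assms(1) show ?thesis by (simp add: mult_pos_neg)
    next
      case False
      then have "2 * real r + 1 - 2 * real i > 0" by linarith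
      with False assms(1) show ?thesis by simp
    qed
  qed
  then show ?thesis unfolding e by (simp only: prod.distrib)
qed

lemma enumerates_roots_exists:
  assumes "mu > 0"
  shows "\<exists>\<alpha>. enumerates_roots N mu \<alpha>"
proof -
  define f where "f = (\<Prod>r<N. [:2 * mu * (2 * real r + 1), 1:])
    + (\<Prod>r<N. [:2 * mu * (2 * real r + 2), 1:])"
  have pf: "poly f x = (\<Prod>r<N. 2 * mu * (2 * real r + 1) + x)
    + (\<Prod>r<N. 2 * mu * (2 * real r + 2) + x)" for x
    by (simp add: f_def poly_prod)
  have s1: "(-1) ^ i * poly f (- 2 * mu * (2 * real i + 1)) > 0" if "i < N" for i
  proof -
    have "(\<Prod>r<N. 2 * mu * (2 * real r + 1) + (- 2 * mu * (2 * real i + 1))) = 0"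
      using that by (intro prod_zero) auto
    moreover have "(\<Prod>r<N. 2 * mu * (2 * real r + 2) + (- 2 * mu * (2 * real i + 1)))
       = (\<Prod>r<N. 2 * mu * (2 * real r + 1 - 2 * real i))"
      by (intro prod.cong) (auto simp: algebra_simps)
    ultimately show ?thesis using prod_sign[OF assms, of i N] that by (simp only: pf) simp
  qed
  have s2: "(-1) ^ i * poly f (- 2 * mu * (2 * real i + 2)) < 0" if "i < N" for i
  proof -
    have "(\<Prod>r<N. 2 * mu * (2 * real r + 2) + (- 2 * mu * (2 * real i + 2))) = 0"
      using that by (intro prod_zero) auto
    moreover have "(\<Prod>r<N. 2 * mu * (2 * real r + 1) + (- 2 * mu * (2 * real i + 2)))
       = (\<Prod>r<N. 2 * mu * (2 * real r + 1 - 2 * real (Suc i)))"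
      by (intro prod.cong) (auto simp: algebra_simps)
    ultimately show ?thesis using prod_sign[OF assms, of "Suc i" N] that by (simp only: pf) simp
  qed
  have "\<exists>x. - 2 * mu * (2 * real i + 2) < x \<and> x < - 2 * mu * (2 * real i + 1) \<and> poly f x = 0"
    if "i < N" for i
  proof -
    have "poly (smult ((-1) ^ i) f) (- 2 * mu * (2 * real i + 2)) < 0"
      "poly (smult ((-1) ^ i) f) (- 2 * mu * (2 * real i + 1)) > 0"
      using s1[OF that] s2[OF that] by simp_all
    moreover have "- 2 * mu * (2 * real i + 2) < - 2 * mu * (2 * real i + 1)"
      using assms by simp
    ultimately obtain x where "- 2 * mu * (2 * real i + 2) < x"
      "x < - 2 * mu * (2 * real i + 1)" "poly (smult ((-1) ^ i) f) x = 0"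
      using poly_IVT_pos by blast
    then show ?thesis by auto
  qed
  then obtain b where b: "\<And>i. i < N \<Longrightarrow> - 2 * mu * (2 * real i + 2) < b i"
    "\<And>i. i < N \<Longrightarrow> b i < - 2 * mu * (2 * real i + 1)" "\<And>i. i < N \<Longrightarrow> poly f (b i) = 0"
    by metis
  define \<alpha> where "\<alpha> k = (if k = 1 then 0 else b (k - 2))" for k
  have dec: "\<alpha> j < \<alpha> i" if "i \<in> {1..N+1}" "j \<in> {1..N+1}" "i < j" for i j
  proof (cases "i = 1")
    case True
    have "j - 2 < N" using that by auto
    have "- 2 * mu * (2 * real (j - 2) + 1) < 0" using assms by (simp add: add_pos_nonneg)
    then show ?thesis using True that b(2)[OF \<open>j - 2 < N\<close>] by (simp add: \<alpha>_def)
  next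
    case False
    have n: "i - 2 < N" "j - 2 < N" "i - 2 < j - 2" using that False by auto
    then have "real (i - 2) + 1 \<le> real (j - 2)" by linarith
    then have "2 * mu * (2 * real (i - 2) + 2) \<le> 2 * mu * (2 * real (j - 2) + 1)"
      using assms by (intro mult_left_mono) auto
    then show ?thesis using b(2)[OF n(2)] b(1)[OF n(1)] that False by (simp add: \<alpha>_def)
  qed
  have P: "char_poly_P N mu = [:0, 1:] * f" by (simp add: char_poly_P_def f_def)
  have sub: "\<alpha> ` {1..N+1} \<subseteq> {x. poly (char_poly_P N mu) x = 0}"
  proof clarify
    fix k assume "k \<in> {1..N+1}"
    then have "k = 1 \<or> k - 2 < N" by auto
    then show "poly (char_poly_P N mu) (\<alpha> k) = 0" using b(3) by (auto simp: P \<alpha>_def)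
  qed
  have "poly f 1 > 0" unfolding pf using assms
    by (intro add_pos_pos prod_pos ballI add_nonneg_pos) auto
  then have "f \<noteq> 0" by auto
  then have nz: "char_poly_P N mu \<noteq> 0" by (simp add: P)
  have dp: "degree (\<Prod>r<N. [:h r, 1:]) \<le> N" for h :: "nat \<Rightarrow> real"
    using degree_prod_sum_le[of "{..<N}" "\<lambda>r. [:h r, 1:]"] by simp
  have "degree f \<le> N" unfolding f_def by (intro degree_add_le dp)
  then have "degree (char_poly_P N mu) \<le> N + 1"
    using degree_mult_le[of "[:0, 1:]" f] by (simp add: P)
  then have le: "card {x. poly (char_poly_P N mu) x = 0} \<le> N + 1"
    using card_poly_roots_bound[OF nz] by linarith
  have "inj_on \<alpha> {1..N+1}"
    by (intro linorder_inj_onI) (use dec in force)+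
  then have "card (\<alpha> ` {1..N+1}) = N + 1" by (simp add: card_image)
  then have "\<alpha> ` {1..N+1} = {x. poly (char_poly_P N mu) x = 0}"
    using le by (intro card_seteq[OF poly_roots_finite[OF nz] sub]) auto
  moreover have "\<alpha> 1 = 0" by (simp add: \<alpha>_def)
  ultimately have "enumerates_roots N mu \<alpha>"
    unfolding enumerates_roots_def using dec by blast
  then show ?thesis by blast
qed

end

(* When lam = mu, reading the levels downwards (m = N - k) turns the level process, up to the
   catastrophes, into the Ehrenfest model with 2N balls restricted to m <= N. The Ehrenfest
   generator is diagonalised by the coefficient vectors of (1 - z)^a (1 + z)^(2N - a), with
   eigenvalues -2 mu a. The level-0 probability comes first: for a root alpha of P, the Krawtchouk
   polynomials in the eigenvalue variable, evaluated at alpha, form an eigenvector of the level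
   process, and Lagrange interpolation at the roots adjusts the initial value. The other level
   probabilities then solve the unrestricted Ehrenfest equations with an explicit source
   proportional to p(0, t), and expanding z^N and z^N - z^(N+1) in the eigenvectors gives the
   formula. *)
theory Submission
  imports Defs
begin

section \<open>Forward equations of a transition function\<close>

text \<open>The obstacle is level 0: it is left at rate \<open>mu * N\<close>, while every other
  level is left at rate \<open>2 * mu * N\<close> (catastrophes aside). On m <= N this defect
  changes the last eigenvalue equation into the condition that P vanishes, so the eigenvalues become
  the roots \<alpha>. On 0..2N the eigenvectors are explicit, but the defect has to be repaired by a
  source containing p(0,t); hence level 0 must be settled before the others. Catastrophes only shift
  the picture: the total mass is 1, so their inflow into level 0 is xi (1 - p(0,t)), which amounts
  to damping every level by xi and feeding level 0 at the constant rate xi. A mode of decay y then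
  obeys V' = xi - (xi + y) V with V(0) = 1, solved by 1 - theta2(t, y). Phases drop out because the
  rows of C sum to 1. The sums theta1 have argument 2 because 1 - z = (1 + z) - 2z. The powers of 2
  in the formula come from (1 + z)^2 - (1 - z)^2 = 4z and (1 - z)(1 + z) - (1 - z)^2 = 2z(1 -
  z).\<close>

lemma transition_function_rate:
  assumes "transition_function S q Pt" "x \<in> S" "y \<in> S" "x \<noteq> y"
  shows "((\<lambda>h. Pt h x y / h) \<longlongrightarrow> q x y) (at_right 0)"
  using assms(1)[unfolded transition_function_def, THEN conjunct2, THEN conjunct2, THEN conjunct2]
    assms(2-4) by blast

lemma transition_function_semigroup:
  assumes "transition_function S q Pt" "x \<in> S" "y \<in> S" "0 \<le> s" "0 \<le> t"
  shows "Pt (s + t) x y = (\<Sum>z\<in>S. Pt s x z * Pt t z y)"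
  using assms(1)[unfolded transition_function_def, THEN conjunct2, THEN conjunct2, THEN conjunct1,
      rule_format, OF assms(4,5,2,3)] .

lemma transition_function_0:
  assumes "transition_function S q Pt" "x \<in> S" "y \<in> S"
  shows "Pt 0 x y = (if x = y then 1 else 0)"
  using assms(1)[unfolded transition_function_def, THEN conjunct2, THEN conjunct1,
      rule_format, OF assms(2,3)] .

lemma transition_function_row_sum:
  assumes "transition_function S q Pt" "x \<in> S" "0 \<le> t"
  shows "(\<Sum>y\<in>S. Pt t x y) = 1"
  using assms(1)[unfolded transition_function_def, THEN conjunct1, rule_format, OF assms(3)] assms(2)
  unfolding stochastic_matrix_on_def by blast

lemma transition_function_nonneg:
  assumes "transition_function S q Pt" "x \<in> S" "y \<in> S" "0 \<le> t"
  shows "0 \<le> Pt t x y"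
  using assms(1)[unfolded transition_function_def, THEN conjunct1, rule_format, OF assms(4)] assms(2,3)
  unfolding stochastic_matrix_on_def by blast

text \<open>Off the diagonal, \<open>Pt h z w\<close> is the rate quotient times \<open>h\<close>,
  which vanishes in the limit; the diagonal entry is 1 minus the finite sum of those
  entries.\<close>

lemma transition_function_continuous_at_0:
  assumes "finite S" "transition_function S q Pt" "z \<in> S" "y \<in> S"
  shows "((\<lambda>h. Pt h z y) \<longlongrightarrow> (if z = y then 1 else 0)) (at_right 0)"
proof -
  have off: "((\<lambda>h. Pt h z w) \<longlongrightarrow> 0) (at_right 0)" if "w \<in> S" "w \<noteq> z" for w
  proof -
    have "((\<lambda>h. Pt h z w / h) \<longlongrightarrow> q z w) (at_right 0)"
      by (rule transition_function_rate[OF assms(2,3) that(1) that(2)[symmetric]])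
    then have "((\<lambda>h. Pt h z w / h * h) \<longlongrightarrow> q z w * 0) (at_right 0)"
      by (intro tendsto_mult) (auto intro: tendsto_ident_at)
    moreover have "\<forall>\<^sub>F h in at_right 0. Pt h z w / h * h = Pt h z w"
      by (rule eventually_at_rightI[of 0 1]) auto
    ultimately show ?thesis by (simp add: filterlim_cong[OF refl refl])
  qed
  show ?thesis
  proof (cases "z = y")
    case False
    then show ?thesis using off[OF assms(4)] by auto
  next
    case True
    have "((\<lambda>h. 1 - (\<Sum>w\<in>S-{z}. Pt h z w)) \<longlongrightarrow> 1 - (\<Sum>w\<in>S-{z}. 0)) (at_right 0)"
      by (intro tendsto_diff tendsto_sum tendsto_const off) auto
    moreover have "\<forall>\<^sub>F h in at_right 0. 1 - (\<Sum>w\<in>S-{z}. Pt h z w) = Pt h z y"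
    proof (rule eventually_at_rightI[of 0 1])
      fix h :: real assume "h \<in> {0<..<1}"
      then have "(\<Sum>w\<in>S. Pt h z w) = 1"
        using transition_function_row_sum[OF assms(2,3)] by simp
      then show "1 - (\<Sum>w\<in>S-{z}. Pt h z w) = Pt h z y"
        using sum.remove[OF assms(1,3), of "Pt h z"] True by simp
    qed simp
    ultimately show ?thesis using True by (simp add: filterlim_cong[OF refl refl])
  qed
qed

text \<open>Since a row sums to 1, the increment is an average of \<open>f y - f z\<close>. The term
  \<open>y = z\<close> vanishes, which leaves the rate limits for distinct states.\<close>

lemma transition_function_increment:
  assumes "finite S" "transition_function S q Pt" "z \<in> S"
  shows "((\<lambda>h. ((\<Sum>y\<in>S. Pt h z y * f y) - f z) / h) \<longlongrightarrow> (\<Sum>y\<in>S. q z y * (f y - f z)))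
    (at_right 0)"
proof -
  have "((\<lambda>h. Pt h z y / h * (f y - f z)) \<longlongrightarrow> q z y * (f y - f z)) (at_right 0)" if "y \<in> S" for y
  proof (cases "y = z")
    case False
    have "((\<lambda>h. Pt h z y / h) \<longlongrightarrow> q z y) (at_right 0)"
      using transition_function_rate[OF assms(2,3) that] False by auto
    then show ?thesis by (intro tendsto_mult tendsto_const)
  qed simp
  then have "((\<lambda>h. \<Sum>y\<in>S. Pt h z y / h * (f y - f z)) \<longlongrightarrow> (\<Sum>y\<in>S. q z y * (f y - f z))) (at_right 0)"
    by (intro tendsto_sum)
  moreover have "\<forall>\<^sub>F h in at_right 0. (\<Sum>y\<in>S. Pt h z y / h * (f y - f z))
     = ((\<Sum>y\<in>S. Pt h z y * f y) - f z) / h"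
  proof (rule eventually_at_rightI[of 0 1])
    fix h :: real assume "h \<in> {0<..<1}"
    then have *: "(\<Sum>w\<in>S. Pt h z w) = 1"
      using transition_function_row_sum[OF assms(2,3)] by simp
    have "(\<Sum>y\<in>S. Pt h z y / h * (f y - f z))
      = ((\<Sum>y\<in>S. Pt h z y * f y) - (\<Sum>y\<in>S. Pt h z y) * f z) / h"
      by (simp add: sum_divide_distrib sum_distrib_right sum_subtractf diff_divide_distrib
          right_diff_distrib)
    then show "(\<Sum>y\<in>S. Pt h z y / h * (f y - f z)) = ((\<Sum>y\<in>S. Pt h z y * f y) - f z) / h"
      using * by simp
  qed simp
  ultimately show ?thesis by (simp add: filterlim_cong[OF refl refl])
qed

lemma transition_function_bounds:
  assumes "finite S" "transition_function S q Pt" "x \<in> S" "y \<in> S" "t \<ge> 0"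
  shows "0 \<le> Pt t x y" "Pt t x y \<le> 1"
proof -
  have *: "\<forall>w\<in>S. 0 \<le> Pt t x w" "(\<Sum>w\<in>S. Pt t x w) = 1"
    using transition_function_nonneg[OF assms(2,3) _ assms(5)]
      transition_function_row_sum[OF assms(2,3,5)] by auto
  then show "0 \<le> Pt t x y" using assms by auto
  show "Pt t x y \<le> 1" using member_le_sum[OF assms(4), of "Pt t x"] * assms(1) by simp
qed

text \<open>The semigroup law for \<open>(t - h) + h\<close> writes
  \<open>Pt t x y - Pt (t - h) x y\<close> with entries of \<open>Pt (t - h)\<close> against
  \<open>Pt h\<close> minus the identity. The former are bounded by 1, the latter tend to 0.\<close>

lemma transition_function_left_continuous:
  assumes "finite S" "transition_function S q Pt" "x \<in> S" "y \<in> S" "t > 0"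
  shows "((\<lambda>h. Pt (t - h) x y) \<longlongrightarrow> Pt t x y) (at_right 0)"
proof -
  let ?D = "\<lambda>z. if z = y then 1 else 0 :: real"
  have "((\<lambda>h. \<Sum>z\<in>S. Pt (t - h) x z * (Pt h z y - ?D z)) \<longlongrightarrow> (\<Sum>z\<in>S. 0)) (at_right 0)"
  proof (rule tendsto_sum)
    fix z assume z: "z \<in> S"
    have "((\<lambda>h. Pt h z y - ?D z) \<longlongrightarrow> ?D z - ?D z) (at_right 0)"
      by (intro tendsto_diff tendsto_const transition_function_continuous_at_0[OF assms(1,2) z assms(4)])
    then have "((\<lambda>h. \<bar>Pt h z y - ?D z\<bar>) \<longlongrightarrow> 0) (at_right 0)"
      by (intro tendsto_rabs_zero) simp
    then show "((\<lambda>h. Pt (t - h) x z * (Pt h z y - ?D z)) \<longlongrightarrow> 0) (at_right 0)"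
    proof (rule Lim_null_comparison[rotated])
      show "\<forall>\<^sub>F h in at_right 0. norm (Pt (t - h) x z * (Pt h z y - ?D z)) \<le> \<bar>Pt h z y - ?D z\<bar>"
      proof (rule eventually_at_rightI[of 0 t])
        fix h assume "h \<in> {0<..<t}"
        then have "0 \<le> Pt (t - h) x z" "Pt (t - h) x z \<le> 1"
          using transition_function_bounds[OF assms(1-3) z, of "t - h"] by auto
        then show "norm (Pt (t - h) x z * (Pt h z y - ?D z)) \<le> \<bar>Pt h z y - ?D z\<bar>"
          by (simp add: abs_mult mult_left_le_one_le)
      qed (use assms in simp)
    qed
  qed
  then have "((\<lambda>h. Pt t x y - (\<Sum>z\<in>S. Pt (t - h) x z * (Pt h z y - ?D z))) \<longlongrightarrow> Pt t x y - 0)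
     (at_right 0)"
    by (intro tendsto_diff tendsto_const) simp
  moreover have "\<forall>\<^sub>F h in at_right 0. Pt t x y - (\<Sum>z\<in>S. Pt (t - h) x z * (Pt h z y - ?D z))
     = Pt (t - h) x y"
  proof (rule eventually_at_rightI[of 0 t])
    fix h assume h: "h \<in> {0<..<t}"
    have "Pt (t - h + h) x y = (\<Sum>z\<in>S. Pt (t - h) x z * Pt h z y)"
      using h by (intro transition_function_semigroup[OF assms(2-4)]) auto
    then have "Pt t x y = (\<Sum>z\<in>S. Pt (t - h) x z * Pt h z y)" by simp
    moreover have "(\<Sum>z\<in>S. Pt (t - h) x z * ?D z) = Pt (t - h) x y"
      using assms(1,4) by (simp add: sum.delta if_distrib cong: if_cong)
    ultimately show "Pt t x y - (\<Sum>z\<in>S. Pt (t - h) x z * (Pt h z y - ?D z)) = Pt (t - h) x y"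
      by (simp add: right_diff_distrib sum_subtractf)
  qed (use assms in simp)
  ultimately show ?thesis by (simp add: filterlim_cong[OF refl refl])
qed

text \<open>Stated for the expectation of an arbitrary \<open>f\<close>, so that functions of the
  level alone can be inserted later. The right quotient keeps \<open>Pt t\<close> fixed and lets the
  short step act last; the left quotient has \<open>Pt (t - h)\<close> in its place, which is where
  left continuity enters.\<close>

lemma transition_function_forward:
  assumes fin: "finite S" and tf: "transition_function S q Pt" and x: "x \<in> S" and "t \<ge> 0"
  shows "((\<lambda>t. \<Sum>y\<in>S. Pt t x y * f y) has_real_derivative
    (\<Sum>z\<in>S. Pt t x z * (\<Sum>y\<in>S. q z y * (f y - f z)))) (at t within {0..})"
proof -
  define U where "U h z = (\<Sum>y\<in>S. Pt h z y * f y)" for h z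
  define D where "D = (\<Sum>z\<in>S. Pt t x z * (\<Sum>y\<in>S. q z y * (f y - f z)))"
  have semi: "U (s + h) x - U s x = (\<Sum>z\<in>S. Pt s x z * (U h z - f z))" if "s \<ge> 0" "h \<ge> 0" for s h
  proof -
    have "U (s + h) x = (\<Sum>y\<in>S. (\<Sum>z\<in>S. Pt s x z * Pt h z y) * f y)"
      unfolding U_def by (intro sum.cong refl) (simp add: transition_function_semigroup[OF tf x _ that])
    also have "\<dots> = (\<Sum>z\<in>S. Pt s x z * U h z)"
      unfolding U_def by (simp add: sum_distrib_left sum_distrib_right mult.assoc) (rule sum.swap)
    finally show ?thesis by (simp add: U_def[of s] right_diff_distrib sum_subtractf)
  qed
  note incr = transition_function_increment[OF fin tf, where f = f, folded U_def]
  have right: "((\<lambda>h. (U (t + h) x - U t x) / h) \<longlongrightarrow> D) (at_right 0)"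
  proof -
    have "((\<lambda>h. \<Sum>z\<in>S. Pt t x z * ((U h z - f z) / h)) \<longlongrightarrow> D) (at_right 0)"
      unfolding D_def by (intro tendsto_sum tendsto_mult tendsto_const incr)
    moreover have "\<forall>\<^sub>F h in at_right 0. (\<Sum>z\<in>S. Pt t x z * ((U h z - f z) / h))
       = (U (t + h) x - U t x) / h"
      by (rule eventually_at_rightI[of 0 1]) (use semi \<open>t \<ge> 0\<close> in \<open>auto simp: sum_divide_distrib\<close>)
    ultimately show ?thesis by (simp add: filterlim_cong[OF refl refl])
  qed
  have R: "((\<lambda>y. (U y x - U t x) / (y - t)) \<longlongrightarrow> D) (at_right t)"
    unfolding filterlim_at_right_to_0[of _ _ t] using right by (simp add: add.commute)
  have "((\<lambda>t. U t x) has_real_derivative D) (at t within {0..})"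
  proof (cases "t = 0")
    case True
    then show ?thesis using R unfolding has_field_derivative_iff
      by (simp add: at_within_Ici_at_right)
  next
    case False
    with \<open>t \<ge> 0\<close> have "t > 0" by simp
    have left: "((\<lambda>h. (U t x - U (t - h) x) / h) \<longlongrightarrow> D) (at_right 0)"
    proof -
      have "((\<lambda>h. \<Sum>z\<in>S. Pt (t - h) x z * ((U h z - f z) / h)) \<longlongrightarrow> D) (at_right 0)"
        unfolding D_def
        by (intro tendsto_sum tendsto_mult incr
            transition_function_left_continuous[OF fin tf x _ \<open>t > 0\<close>])
      moreover have "\<forall>\<^sub>F h in at_right 0. (\<Sum>z\<in>S. Pt (t - h) x z * ((U h z - f z) / h))
         = (U t x - U (t - h) x) / h"
      proof (rule eventually_at_rightI[of 0 t])
        fix h assume "h \<in> {0<..<t}"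
        then show "(\<Sum>z\<in>S. Pt (t - h) x z * ((U h z - f z) / h)) = (U t x - U (t - h) x) / h"
          using semi[of "t - h" h] by (simp add: sum_divide_distrib)
      qed (use \<open>t > 0\<close> in simp)
      ultimately show ?thesis by (simp add: filterlim_cong[OF refl refl])
    qed
    have "(U (t - h) x - U t x) / ((t - h) - t) = (U t x - U (t - h) x) / h" for h
      by (simp add: minus_divide_left[symmetric] divide_simps)
    then have "((\<lambda>h. (U (t - h) x - U t x) / ((t - h) - t)) \<longlongrightarrow> D) (at_right 0)"
      using left by presburger
    then have "((\<lambda>y. (U y x - U t x) / (y - t)) \<longlongrightarrow> D) (at_left t)"
      unfolding filterlim_at_left_to_right[of _ _ t] filterlim_at_right_to_0[of _ _ "-t"] by simp
    then have "((\<lambda>y. (U y x - U t x) / (y - t)) \<longlongrightarrow> D) (at t)"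
      using R by (rule filterlim_split_at)
    moreover have "at t within {0..} = at t"
      using \<open>t > 0\<close> by (intro at_within_interior) simp
    ultimately show ?thesis unfolding has_field_derivative_iff by simp
  qed
  then show ?thesis by (simp add: U_def D_def)
qed

section \<open>Linear differential equations\<close>

text \<open>Gronwall's argument for the sum of squares \<open>E\<close>: the function
  \<open>E t * exp (- K * t)\<close> is nonincreasing, nonnegative and starts at 0.\<close>

lemma linear_ode_zero:
  fixes u :: "'i \<Rightarrow> real \<Rightarrow> real"
  assumes fin: "finite I"
    and der: "\<And>i t. i \<in> I \<Longrightarrow> t \<ge> 0 \<Longrightarrow>
      (u i has_real_derivative (\<Sum>j\<in>I. A i j * u j t)) (at t within {0..})"
    and init: "\<And>i. i \<in> I \<Longrightarrow> u i 0 = 0"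
    and "i \<in> I" "t \<ge> 0"
  shows "u i t = 0"
proof -
  \<comment> \<open>Each product of two components is bounded by \<open>E\<close>, so
    \<open>E'\<close> is at most this constant times \<open>E\<close>; the 2 comes from
    differentiating the squares.\<close>
  define K where "K = 2 * (\<Sum>i\<in>I. \<Sum>j\<in>I. \<bar>A i j\<bar>)"
  define E where "E t = (\<Sum>i\<in>I. (u i t)\<^sup>2)" for t
  define E' where "E' t = (\<Sum>i\<in>I. 2 * u i t * (\<Sum>j\<in>I. A i j * u j t))" for t
  have dE: "(E has_real_derivative E' t) (at t within {0..})" if "t \<ge> 0" for t
    unfolding E_def E'_def using that
    by (auto intro!: derivative_eq_intros der simp: algebra_simps)
  have bound: "E' t \<le> K * E t" for t
  proof -
    have le: "\<bar>u i t\<bar> * \<bar>u j t\<bar> \<le> E t" if "i \<in> I" "j \<in> I" for i j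
    proof -
      have "(u i t)\<^sup>2 \<le> E t" "(u j t)\<^sup>2 \<le> E t"
        unfolding E_def using that fin
        by (auto intro: member_le_sum[of _ I "\<lambda>i. (u i t)\<^sup>2"])
      moreover have "2 * (\<bar>u i t\<bar> * \<bar>u j t\<bar>) \<le> (u i t)\<^sup>2 + (u j t)\<^sup>2"
        using sum_squares_bound[of "\<bar>u i t\<bar>" "\<bar>u j t\<bar>"] by simp
      ultimately show ?thesis by linarith
    qed
    have "E' t = (\<Sum>i\<in>I. \<Sum>j\<in>I. 2 * (A i j * (u i t * u j t)))"
      unfolding E'_def by (simp add: sum_distrib_left mult_ac)
    also have "\<dots> \<le> (\<Sum>i\<in>I. \<Sum>j\<in>I. 2 * (\<bar>A i j\<bar> * E t))"
    proof (intro sum_mono mult_left_mono)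
      fix i j assume "i \<in> I" "j \<in> I"
      have "A i j * (u i t * u j t) \<le> \<bar>A i j\<bar> * (\<bar>u i t\<bar> * \<bar>u j t\<bar>)"
        by (metis abs_ge_self abs_mult)
      also have "\<dots> \<le> \<bar>A i j\<bar> * E t" by (intro mult_left_mono le \<open>i \<in> I\<close> \<open>j \<in> I\<close>) auto
      finally show "A i j * (u i t * u j t) \<le> \<bar>A i j\<bar> * E t" .
    qed auto
    also have "\<dots> = K * E t"
      unfolding K_def by (simp add: sum_distrib_left sum_distrib_right mult_ac)
    finally show ?thesis .
  qed
  have "E t * exp (- K * t) \<le> E 0 * exp (- K * 0)"
  proof (rule DERIV_nonpos_imp_decreasing_open[OF \<open>t \<ge> 0\<close>])
    fix s assume s: "0 < s" "s < t"
    have "(E has_real_derivative E' s) (at s)"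
      using dE[of s] s at_within_interior[of s "{0..}"] by simp
    then have "((\<lambda>s. E s * exp (- K * s)) has_real_derivative (E' s - K * E s) * exp (- K * s)) (at s)"
      by (auto intro!: derivative_eq_intros simp: algebra_simps)
    moreover have "(E' s - K * E s) * exp (- K * s) \<le> 0"
      using bound[of s] by (simp add: mult_nonpos_nonneg)
    ultimately show "\<exists>y. ((\<lambda>s. E s * exp (- K * s)) has_real_derivative y) (at s) \<and> y \<le> 0" by blast
  next
    have "continuous_on {0..} E"
      using dE by (intro DERIV_continuous_on) auto
    then have "continuous_on {0..t} E" by (rule continuous_on_subset) auto
    then show "continuous_on {0..t} (\<lambda>s. E s * exp (- K * s))" by (intro continuous_intros)
  qed
  moreover have "E 0 = 0" by (simp add: E_def init)
  ultimately have "E t \<le> 0" by (simp add: mult_le_0_iff)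
  moreover have "(u i t)\<^sup>2 \<le> E t"
    unfolding E_def using member_le_sum[OF \<open>i \<in> I\<close>, of "\<lambda>i. (u i t)\<^sup>2"] fin by simp
  ultimately have "(u i t)\<^sup>2 \<le> 0" by linarith
  then show ?thesis by simp
qed

text \<open>The difference of two solutions loses the common source \<open>f\<close> and solves a
  homogeneous system. This shape serves both the level process on 0..N and the Ehrenfest chain on
  0..2N; the conditionals keep \<open>m - 1\<close> and \<open>m + 1\<close> inside the index
  range.\<close>

lemma tridiagonal_ode_unique:
  fixes u v :: "nat \<Rightarrow> real \<Rightarrow> real"
  assumes der_u: "\<And>m t. m \<le> n \<Longrightarrow> t \<ge> 0 \<Longrightarrow> (u m has_real_derivative
      (if m = 0 then 0 else a m * u (m - 1) t) + b m * u m t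
      + (if m = n then 0 else c m * u (m + 1) t) + f m t) (at t within {0..})"
    and der_v: "\<And>m t. m \<le> n \<Longrightarrow> t \<ge> 0 \<Longrightarrow> (v m has_real_derivative
      (if m = 0 then 0 else a m * v (m - 1) t) + b m * v m t
      + (if m = n then 0 else c m * v (m + 1) t) + f m t) (at t within {0..})"
    and init: "\<And>m. m \<le> n \<Longrightarrow> u m 0 = v m 0"
    and "m \<le> n" "t \<ge> 0"
  shows "u m t = v m t"
proof -
  define A where "A i j = (if j + 1 = i then a i else 0) + (if j = i then b i else 0)
    + (if j = i + 1 then c i else 0)" for i j
  have "u m t - v m t = 0"
  proof (rule linear_ode_zero[of "{..n}" "\<lambda>m t. u m t - v m t" A])
    fix i and s :: real assume i: "i \<in> {..n}" and s: "0 \<le> s"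
    let ?w = "\<lambda>m. u m s - v m s"
    have "(\<Sum>j\<le>n. A i j * ?w j) = (\<Sum>j\<le>n. if j + 1 = i then a i * ?w j else 0)
      + (\<Sum>j\<le>n. if j = i then b i * ?w j else 0) + (\<Sum>j\<le>n. if j = i + 1 then c i * ?w j else 0)"
      unfolding A_def sum.distrib[symmetric] by (intro sum.cong) auto
    also have "(\<Sum>j\<le>n. if j + 1 = i then a i * ?w j else 0) = (if i = 0 then 0 else a i * ?w (i - 1))"
    proof (cases i)
      case (Suc k)
      then have "(\<Sum>j\<le>n. if j + 1 = i then a i * ?w j else 0) = (\<Sum>j\<le>n. if j = k then a i * ?w j else 0)"
        by (intro sum.cong) auto
      then show ?thesis using Suc i by (simp add: sum.delta)
    qed simp
    also have "(\<Sum>j\<le>n. if j = i then b i * ?w j else 0) = b i * ?w i"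
      using i by (simp add: sum.delta)
    also have "(\<Sum>j\<le>n. if j = i + 1 then c i * ?w j else 0) = (if i = n then 0 else c i * ?w (i + 1))"
      using i by (simp add: sum.delta)
    finally have *: "(\<Sum>j\<le>n. A i j * ?w j) = (if i = 0 then 0 else a i * ?w (i - 1)) + b i * ?w i
      + (if i = n then 0 else c i * ?w (i + 1))" .
    have "((\<lambda>t. u i t - v i t) has_real_derivative
       ((if i = 0 then 0 else a i * u (i - 1) s) + b i * u i s + (if i = n then 0 else c i * u (i + 1) s) + f i s)
     - ((if i = 0 then 0 else a i * v (i - 1) s) + b i * v i s + (if i = n then 0 else c i * v (i + 1) s) + f i s))
       (at s within {0..})"
      using i s by (intro DERIV_diff der_u der_v) auto
    then show "((\<lambda>t. u i t - v i t) has_real_derivative (\<Sum>j\<le>n. A i j * ?w j)) (at s within {0..})"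
      unfolding * by (rule back_subst[where P = "\<lambda>D. (_ has_real_derivative D) _"])
        (auto simp: algebra_simps)
  qed (use assms in auto)
  then show ?thesis by simp
qed

section \<open>Level probabilities\<close>

text \<open>This is lumpability: the result does not mention the phase \<open>l\<close>, because a
  jump out of level 0 distributes the phases with total weight 1 and every other jump keeps the
  phase.\<close>

lemma rates_level_sum:
  assumes "N \<ge> 1" "stochastic_matrix_on {1..d} c" "i \<le> N" "l \<in> {1..d}"
  shows "(\<Sum>y\<in>states N d. rates N c lam mu xi (i, l) y * g (fst y)) =
    (if i = 0 then lam * real N * g 1
     else lam * (real N - real i) * g (i + 1) + mu * (real N + real i) * g (i - 1) + xi * g 0)"
proof -
  have one: "(\<Sum>j=1..d. \<Sum>k\<le>N. if k = k0 \<and> j = l then x else 0) = (x::real)"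
    if "k0 \<le> N" for k0 x
  proof -
    have "(\<Sum>j=1..d. \<Sum>k\<le>N. if k = k0 \<and> j = l then x else 0) = (\<Sum>j=1..d. if j = l then x else 0)"
    proof (rule sum.cong[OF refl])
      fix j show "(\<Sum>k\<le>N. if k = k0 \<and> j = l then x else 0) = (if j = l then x else 0)"
        using that by (cases "j = l") (simp_all add: sum.delta)
    qed
    then show ?thesis using assms(4) by (simp add: sum.delta)
  qed
  have split: "(\<Sum>y\<in>states N d. F (fst y) (snd y)) = (\<Sum>j=1..d. \<Sum>k\<le>N. F k j)" for F :: "nat \<Rightarrow> nat \<Rightarrow> real"
    by (subst sum.swap) (simp add: sum.cartesian_product atLeast0AtMost case_prod_beta)
  show ?thesis
  proof (cases "i = 0")
    case True
    have "(\<Sum>y\<in>states N d. rates N c lam mu xi (i, l) y * g (fst y))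
      = (\<Sum>j=1..d. \<Sum>k\<le>N. if k = 1 then c l j * lam * real N * g 1 else 0)"
      unfolding split[symmetric] using True
      by (intro sum.cong) (auto simp: rates_def)
    also have "\<dots> = (\<Sum>j=1..d. c l j * (lam * real N * g 1))"
      using assms(1) by (simp add: sum.delta mult.assoc)
    also have "\<dots> = lam * real N * g 1"
      unfolding sum_distrib_right[symmetric] using assms(2,4)
      by (simp add: stochastic_matrix_on_def)
    finally show ?thesis using True by simp
  next
    case False
    have up: "i \<le> N - Suc 0 \<longleftrightarrow> i < N" using False assms(3) by auto
    let ?a = "if i < N then lam * (real N - real i) * g (i + 1) else 0"
    \<comment> \<open>At the top level there is no upward jump. The target 0 is then a dummy with
      value \<open>?a = 0\<close>, chosen inside 0..N so that one summation rule covers all three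
      terms.\<close>
    let ?k = "if i < N then i + 1 else 0"
    have "(\<Sum>y\<in>states N d. rates N c lam mu xi (i, l) y * g (fst y))
      = (\<Sum>y\<in>states N d. (if fst y = ?k \<and> snd y = l then ?a else 0)
         + (if fst y = i - 1 \<and> snd y = l then mu * (real N + real i) * g (i - 1) else 0)
         + (if fst y = 0 \<and> snd y = l then xi * g 0 else 0))"
      using False assms(3) by (intro sum.cong) (auto simp: rates_def distrib_right up)
    also have "\<dots> = ?a + mu * (real N + real i) * g (i - 1) + xi * g 0"
    proof -
      have "(\<Sum>y\<in>states N d. if fst y = k0 \<and> snd y = l then x else 0) = x" if "k0 \<le> N" for k0 and x :: real
        using one[OF that, of x] split[of "\<lambda>k j. if k = k0 \<and> j = l then x else 0"] by simp
      then show ?thesis using assms(3) unfolding sum.distrib by simp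
    qed
    finally show ?thesis using False assms(3) by auto
  qed
qed

text \<open>The case \<open>n = 0\<close> of the Markov property, with the two times 0 and
  \<open>t\<close>; they must be strictly increasing, hence \<open>t > 0\<close>. The conditioning
  event has probability 1 by the initial law, which supplies the positivity premise.\<close>

lemma p_joint_eq_transition:
  assumes mc: "markov_chain_with_rates M S q X"
    and init: "AE \<omega> in M. X 0 \<omega> = x0" and x0: "x0 \<in> S"
  obtains Pt where "transition_function S q Pt"
    "\<And>t y. t > 0 \<Longrightarrow> y \<in> S \<Longrightarrow> \<P>(\<omega> in M. X t \<omega> = y \<bar> X 0 \<omega> = x0) = Pt t x0 y"
proof -
  note mc' = mc[unfolded markov_chain_with_rates_def]
  interpret prob_space M using mc' by (rule conjunct1)
  have meas: "X 0 \<in> M \<rightarrow>\<^sub>M count_space S"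
    using mc'[THEN conjunct2, THEN conjunct2, THEN conjunct1] by simp
  obtain Pt where tf: "transition_function S q Pt" and step:
    "\<forall>(n::nat) \<tau> x. 0 \<le> \<tau> 0 \<and> (\<forall>i\<le>n. \<tau> i < \<tau> (Suc i)) \<and> (\<forall>i\<le>Suc n. x i \<in> S) \<and>
          \<P>(\<omega> in M. \<forall>i\<le>n. X (\<tau> i) \<omega> = x i) > 0 \<longrightarrow>
          \<P>(\<omega> in M. X (\<tau> (Suc n)) \<omega> = x (Suc n) \<bar> \<forall>i\<le>n. X (\<tau> i) \<omega> = x i)
            = Pt (\<tau> (Suc n) - \<tau> n) (x n) (x (Suc n))"
    using mc'[THEN conjunct2, THEN conjunct2, THEN conjunct2] by (elim exE conjE) (rule that; assumption)
  have "{\<omega> \<in> space M. X 0 \<omega> = x0} \<in> events"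
  proof -
    have "X 0 -` {x0} \<inter> space M \<in> events"
      using meas x0 by (intro measurable_sets[OF meas]) auto
    moreover have "X 0 -` {x0} \<inter> space M = {\<omega> \<in> space M. X 0 \<omega> = x0}" by auto
    ultimately show ?thesis by simp
  qed
  then have one: "\<P>(\<omega> in M. X 0 \<omega> = x0) = 1"
    using init by (subst prob_Collect_eq_1) auto
  have "\<P>(\<omega> in M. X t \<omega> = y \<bar> X 0 \<omega> = x0) = Pt t x0 y" if "t > 0" "y \<in> S" for t y
  proof -
    define \<tau> where "\<tau> i = (if i = 0 then 0 else t)" for i :: nat
    define x where "x i = (if i = 0 then x0 else y)" for i :: nat
    have "\<P>(\<omega> in M. X (\<tau> (Suc 0)) \<omega> = x (Suc 0) \<bar> \<forall>i\<le>0. X (\<tau> i) \<omega> = x i)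
      = Pt (\<tau> (Suc 0) - \<tau> 0) (x 0) (x (Suc 0))"
      by (rule step[THEN spec, THEN spec, THEN spec, THEN mp]) (use that x0 one in \<open>auto simp: \<tau>_def x_def\<close>)
    then show ?thesis by (simp add: \<tau>_def x_def)
  qed
  with tf show thesis by (rule that)
qed

text \<open>The functions \<open>p\<close> come from the transition function and therefore also have
  a meaning at time 0, where the initial value is needed. The constant \<open>xi\<close> at level 0
  is the catastrophe inflow combined with total mass 1. Setting \<open>p\<close> to 0 above
  \<open>N\<close> lets one equation cover the top level too.\<close>

lemma p_level_forward_equations:
  assumes N: "N \<ge> 1" and c: "stochastic_matrix_on {1..d} c" and l0: "l0 \<in> {1..d}"
    and mc: "markov_chain_with_rates M (states N d) (rates N c mu mu xi) X"
    and init: "AE \<omega> in M. X 0 \<omega> = (0, l0)"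
  obtains p where "\<And>k t. k \<le> N \<Longrightarrow> t > 0 \<Longrightarrow> p_level M X d l0 k t = p k t"
    "\<And>k. p k 0 = (if k = 0 then 1 else 0)"
    "\<And>t. t \<ge> 0 \<Longrightarrow> (p 0 has_real_derivative
       mu * (real N + 1) * p 1 t - (mu * real N + xi) * p 0 t + xi) (at t within {0..})"
    "\<And>k t. k \<ge> 1 \<Longrightarrow> k \<le> N \<Longrightarrow> t \<ge> 0 \<Longrightarrow> (p k has_real_derivative
       mu * (real N - real k + 1) * p (k - 1) t + mu * (real N + real k + 1) * p (k + 1) t
       - (2 * mu * real N + xi) * p k t) (at t within {0..})"
    "\<And>k t. k > N \<Longrightarrow> p k t = 0"
proof -
  have x0: "(0, l0) \<in> states N d" using l0 by simp
  obtain Pt where tf: "transition_function (states N d) (rates N c mu mu xi) Pt"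
    and Pt: "\<And>t y. t > 0 \<Longrightarrow> y \<in> states N d \<Longrightarrow>
       \<P>(\<omega> in M. X t \<omega> = y \<bar> X 0 \<omega> = (0, l0)) = Pt t (0, l0) y"
    using p_joint_eq_transition[OF mc init x0] by blast
  define E where "E F t = (\<Sum>y\<in>states N d. Pt t (0, l0) y * F (fst y))" for F :: "nat \<Rightarrow> real" and t
  define p where "p k t = E (\<lambda>i. if i = k then 1 else 0) t" for k t
  have E_p: "E F t = (\<Sum>i\<le>N. F i * p i t)" for F t
  proof -
    have "(\<Sum>i\<le>N. F i * p i t)
      = (\<Sum>y\<in>states N d. \<Sum>i\<le>N. F i * (Pt t (0, l0) y * (if fst y = i then 1 else 0)))"
      unfolding p_def E_def sum_distrib_left by (rule sum.swap)
    also have "\<dots> = (\<Sum>y\<in>states N d. Pt t (0, l0) y * F (fst y))"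
    proof (rule sum.cong[OF refl])
      fix y assume y: "y \<in> states N d"
      have "(\<Sum>i\<le>N. F i * (Pt t (0, l0) y * (if fst y = i then 1 else 0)))
        = (\<Sum>i\<le>N. if i = fst y then Pt t (0, l0) y * F i else 0)"
        by (intro sum.cong) auto
      then show "(\<Sum>i\<le>N. F i * (Pt t (0, l0) y * (if fst y = i then 1 else 0)))
        = Pt t (0, l0) y * F (fst y)" using y by (auto simp: sum.delta)
    qed
    finally show ?thesis by (simp add: E_def)
  qed
  \<comment> \<open>The generator of the lumped level chain, acting on a function \<open>F\<close>
    of the level as rates times increments of \<open>F\<close>.\<close>
  define G where "G F i = (if i = 0 then mu * real N * (F 1 - F 0)
     else mu * (real N - real i) * (F (i + 1) - F i) + mu * (real N + real i) * (F (i - 1) - F i)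
        + xi * (F 0 - F i))" for F :: "nat \<Rightarrow> real" and i
  have der: "(E F has_real_derivative (\<Sum>i\<le>N. G F i * p i t)) (at t within {0..})" if "t \<ge> 0" for F t
  proof -
    have "(E F has_real_derivative (\<Sum>z\<in>states N d. Pt t (0, l0) z *
        (\<Sum>y\<in>states N d. rates N c mu mu xi z y * (F (fst y) - F (fst z))))) (at t within {0..})"
      unfolding E_def by (rule transition_function_forward[OF _ tf x0 that]) simp
    also have "(\<Sum>z\<in>states N d. Pt t (0, l0) z *
        (\<Sum>y\<in>states N d. rates N c mu mu xi z y * (F (fst y) - F (fst z)))) = E (G F) t"
      unfolding E_def
    proof (intro sum.cong refl arg_cong2[where f = "(*)"])
      fix z assume "z \<in> states N d"
      then show "(\<Sum>y\<in>states N d. rates N c mu mu xi z y * (F (fst y) - F (fst z))) = G F (fst z)"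
        using rates_level_sum[OF N c, of "fst z" "snd z" mu mu xi "\<lambda>k. F k - F (fst z)"]
        by (auto simp: G_def)
    qed
    finally show ?thesis by (simp add: E_p[of "G F"])
  qed
  have total: "(\<Sum>i\<le>N. p i t) = 1" if "t \<ge> 0" for t
  proof -
    have "(\<Sum>i\<le>N. p i t) = E (\<lambda>_. 1) t" by (simp add: E_p)
    also have "\<dots> = 1" unfolding E_def using transition_function_row_sum[OF tf x0 that] by simp
    finally show ?thesis .
  qed
  have above: "p k t = 0" if "k > N" for k t
    unfolding p_def E_def using that by (intro sum.neutral) auto
  have at: "(\<Sum>i\<le>N. if i = k then f i else 0) = (if k \<le> N then f k else 0)" for k and f :: "nat \<Rightarrow> real"
    by (simp add: sum.delta)
  show thesis
  proof (rule that[of p])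
    fix k and t :: real assume k: "k \<le> N" and t: "t > 0"
    have "p k t = (\<Sum>y\<in>states N d. if fst y = k then Pt t (0, l0) y else 0)"
      unfolding p_def E_def by (intro sum.cong) auto
    also have "\<dots> = (\<Sum>i\<in>{0..N}. \<Sum>j\<in>{1..d}. if i = k then Pt t (0, l0) (i, j) else 0)"
      unfolding sum.cartesian_product by (intro sum.cong) auto
    also have "\<dots> = (\<Sum>i\<in>{0..N}. if i = k then (\<Sum>j\<in>{1..d}. Pt t (0, l0) (i, j)) else 0)"
      by (intro sum.cong) auto
    also have "\<dots> = (\<Sum>j\<in>{1..d}. Pt t (0, l0) (k, j))" using k by (simp add: sum.delta)
    also have "\<dots> = p_level M X d l0 k t"
      unfolding p_level_def p_joint_def using k Pt[OF t] by (intro sum.cong) auto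
    finally show "p_level M X d l0 k t = p k t" by simp
  next
    fix k
    have "p k 0 = (\<Sum>y\<in>states N d. if y = (0, l0) then (if k = 0 then 1 else 0) else 0)"
      unfolding p_def E_def using transition_function_0[OF tf x0] by (intro sum.cong) auto
    also have "\<dots> = (if k = 0 then 1 else 0)" using x0 by (subst sum.delta) auto
    finally show "p k 0 = (if k = 0 then 1 else 0)" .
  next
    fix t :: real assume t: "t \<ge> 0"
    let ?F = "\<lambda>i. if i = 0 then 1 else 0 :: real"
    \<comment> \<open>Catastrophe inflow is counted as \<open>xi\<close> from every level and
      corrected at \<open>i = 0\<close>; the uncorrected part is then \<open>xi\<close> times the
      total mass.\<close>
    have "(\<Sum>i\<le>N. G ?F i * p i t) = (\<Sum>i\<le>N. xi * p i t + (if i = 0 then - (mu * real N + xi) * p i t else 0)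
        + (if i = 1 then mu * (real N + 1) * p i t else 0))"
      by (intro sum.cong refl) (auto simp: G_def algebra_simps)
    also have "\<dots> = mu * (real N + 1) * p 1 t - (mu * real N + xi) * p 0 t + xi"
      unfolding sum.distrib at sum_distrib_left[symmetric] total[OF t] using N by (simp add: algebra_simps)
    finally show "(p 0 has_real_derivative
       mu * (real N + 1) * p 1 t - (mu * real N + xi) * p 0 t + xi) (at t within {0..})"
      using der[OF t, of ?F] by (simp add: p_def[abs_def])
  next
    fix k and t :: real assume k: "k \<ge> 1" "k \<le> N" and t: "t \<ge> 0"
    let ?F = "\<lambda>i. if i = k then 1 else 0 :: real"
    have "(\<Sum>i\<le>N. G ?F i * p i t) = (\<Sum>i\<le>N. (if i = k then - (2 * mu * real N + xi) * p i t else 0)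
        + (if i = k - 1 then mu * (real N - real k + 1) * p i t else 0)
        + (if i = k + 1 then mu * (real N + real k + 1) * p i t else 0))"
    proof (intro sum.cong refl)
      fix i assume "i \<in> {..N}"
      \<comment> \<open>Level 0 needs its own case, since it follows a separate branch of
        \<open>G\<close>; its rate \<open>mu * N\<close> still agrees with
        \<open>mu * (N - k + 1)\<close> at \<open>k = 1\<close>.\<close>
      consider "i = k" | "i = 0" "k = 1" | "i \<noteq> 0" "k = i + 1" | "i = k + 1" | "i \<noteq> k" "i + 1 \<noteq> k" "i \<noteq> k + 1"
        using k by linarith
      then show "G ?F i * p i t = (if i = k then - (2 * mu * real N + xi) * p i t else 0)
        + (if i = k - 1 then mu * (real N - real k + 1) * p i t else 0)
        + (if i = k + 1 then mu * (real N + real k + 1) * p i t else 0)"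
      proof cases
        case 1 then show ?thesis using k by (simp add: G_def algebra_simps)
      next
        case 2 then show ?thesis by (simp add: G_def)
      next
        case 3 then show ?thesis by (simp add: G_def algebra_simps)
      next
        case 4
        then have "i \<noteq> k - 1" "i \<noteq> k" by auto
        then show ?thesis using 4 k by (simp add: G_def algebra_simps)
      next
        case 5
        then have "i \<noteq> k - 1" "i - 1 \<noteq> k" using k by auto
        then show ?thesis using 5 k by (simp add: G_def)
      qed
    qed
    also have "\<dots> = mu * (real N - real k + 1) * p (k - 1) t + mu * (real N + real k + 1) * p (k + 1) t
       - (2 * mu * real N + xi) * p k t"
      unfolding sum.distrib at using k above[of "k + 1" t] by (auto simp: algebra_simps)
    finally show "(p k has_real_derivative
       mu * (real N - real k + 1) * p (k - 1) t + mu * (real N + real k + 1) * p (k + 1) t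
       - (2 * mu * real N + xi) * p k t) (at t within {0..})"
      using der[OF t, of ?F] by (simp add: p_def[abs_def])
  qed (rule above)
qed

section \<open>Generating polynomials of the Krawtchouk values\<close>

text \<open>The generating polynomials of the eigenvectors of the Ehrenfest model with \<open>n\<close> balls: the
  coefficients are values of Krawtchouk polynomials.\<close>

definition krawtchouk_gf :: "nat \<Rightarrow> nat \<Rightarrow> real poly" where
  "krawtchouk_gf n a = [:1, -1:] ^ a * [:1, 1:] ^ (n - a)"

lemma degree_krawtchouk_gf:
  assumes "a \<le> n" shows "degree (krawtchouk_gf n a) = n"
  unfolding krawtchouk_gf_def using assms by (simp add: degree_mult_eq degree_linear_power)

lemma krawtchouk_gf_0: "coeff (krawtchouk_gf n a) 0 = 1"
  unfolding krawtchouk_gf_def by (simp add: poly_0_coeff_0[symmetric])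

text \<open>Reversing the coefficients fixes \<open>1 + z\<close> and negates \<open>1 - z\<close>.
  For odd \<open>a\<close> this annihilates the middle coefficient, for even \<open>a\<close> it
  makes the vector symmetric; both facts drive the factorisations at the eigenvalues.\<close>

lemma krawtchouk_gf_reflect:
  assumes "a \<le> n" "m \<le> n"
  shows "coeff (krawtchouk_gf n a) (n - m) = (-1) ^ a * coeff (krawtchouk_gf n a) m"
proof -
  define X where "X = [:1, -1 :: real:]"
  define Y where "Y = [:1, 1 :: real:]"
  have X: "reflect_poly X = smult (-1) X" and Y: "reflect_poly Y = Y"
    by (simp_all add: reflect_poly_def X_def Y_def)
  have "reflect_poly (krawtchouk_gf n a) = smult ((-1) ^ a) (krawtchouk_gf n a)"
    unfolding krawtchouk_gf_def X_def[symmetric] Y_def[symmetric] reflect_poly_mult reflect_poly_power X Y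
    by (simp only: smult_power mult_smult_left)
  then have "coeff (reflect_poly (krawtchouk_gf n a)) m = (-1) ^ a * coeff (krawtchouk_gf n a) m"
    by simp
  then show ?thesis using assms by (simp add: coeff_reflect_poly degree_krawtchouk_gf)
qed

text \<open>Substituting \<open>-z\<close> for \<open>z\<close> swaps the two factors. This passes
  from the index \<open>2N - a\<close> in the decay rates of the formula to the index
  \<open>a\<close> in its hypergeometric sums, and yields the sign
  \<open>(-1) ^ (N - r)\<close>.\<close>

lemma krawtchouk_gf_complement:
  assumes "a \<le> n"
  shows "coeff (krawtchouk_gf n (n - a)) m = (-1) ^ m * coeff (krawtchouk_gf n a) m"
proof -
  have X: "pcompose [:1, -1:] [:0, -1:] = [:1, 1 :: real:]"
    and Y: "pcompose [:1, 1:] [:0, -1:] = [:1, -1 :: real:]"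
    by (simp_all add: pcompose_pCons)
  have pw: "pcompose (p ^ k) q = pcompose p q ^ k" for p q :: "real poly" and k
    by (induction k) (simp_all add: pcompose_mult pcompose_1)
  have "pcompose (krawtchouk_gf n a) [:0, -1:] = krawtchouk_gf n (n - a)"
    unfolding krawtchouk_gf_def pcompose_mult pw X Y using assms by (simp add: mult.commute)
  then show ?thesis by (metis coeff_pcompose_linear)
qed

text \<open>Splitting off one factor \<open>1 - z\<close> turns an odd index over \<open>2N\<close>
  into an even index over \<open>2N - 1\<close>.\<close>

lemma krawtchouk_gf_Suc:
  "coeff (krawtchouk_gf (Suc n) (Suc a)) m = coeff (krawtchouk_gf n a) m
     - (if m = 0 then 0 else coeff (krawtchouk_gf n a) (m - 1))"
proof -
  have *: "krawtchouk_gf (Suc n) (Suc a) = [:1, -1:] * krawtchouk_gf n a"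
    by (simp only: krawtchouk_gf_def power_Suc mult.assoc diff_Suc_Suc)
  show ?thesis unfolding * by (cases m) (simp_all add: coeff_pCons)
qed

text \<open>The differential equation \<open>(1 - z\<^sup>2) b' = ((n - 2a) - n z) b\<close> read off coefficientwise.\<close>

lemma krawtchouk_gf_recurrence:
  assumes "a \<le> n"
  shows "real (m + 1) * coeff (krawtchouk_gf n a) (m + 1)
     + (if m = 0 then 0 else (real n - real m + 1) * coeff (krawtchouk_gf n a) (m - 1))
     = (real n - 2 * real a) * coeff (krawtchouk_gf n a) m"
proof -
  define X where "X = [:1, -1 :: real:]"
  define Y where "Y = [:1, 1 :: real:]"
  define b where "b = krawtchouk_gf n a"
  have b: "b = X ^ a * Y ^ (n - a)" by (simp add: b_def krawtchouk_gf_def X_def Y_def)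
  have pdX: "pderiv X = [:-1:]" and pdY: "pderiv Y = [:1:]"
    by (simp_all add: X_def Y_def pderiv_pCons)
  \<comment> \<open>Multiplication by \<open>X\<close> restores the exponent lost in the derivative,
    so that no truncated \<open>k - 1\<close> survives.\<close>
  have dX: "X * pderiv (X ^ k) = smult (- real k) (X ^ k)" for k
    by (cases k) (simp_all only: pderiv_power_Suc pdX, simp_all)
  have dY: "Y * pderiv (Y ^ k) = smult (real k) (Y ^ k)" for k
    by (cases k) (simp_all only: pderiv_power_Suc pdY, simp_all)
  have "X * Y * pderiv b = X * Y * (X ^ a * pderiv (Y ^ (n - a)) + Y ^ (n - a) * pderiv (X ^ a))"
    unfolding b pderiv_mult by (rule refl)
  also have "\<dots> = X * X ^ a * (Y * pderiv (Y ^ (n - a))) + Y * Y ^ (n - a) * (X * pderiv (X ^ a))"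
    by (simp only: distrib_left mult_ac)
  also have "\<dots> = smult (real (n - a)) (X * b) - smult (real a) (Y * b)"
    unfolding dX dY b by (simp add: mult_ac)
  finally have eq: "coeff (X * Y * pderiv b) m = coeff (smult (real (n - a)) (X * b) - smult (real a) (Y * b)) m"
    by (rule arg_cong)
  have XY: "X * Y = [:1, 0, -1:]" by (simp add: X_def Y_def)
  have l: "coeff ([:1, 0, -1:] * pderiv b) m
    = real (m + 1) * coeff b (m + 1) - (if m = 0 then 0 else real (m - 1) * coeff b (m - 1))"
  proof (cases m)
    case (Suc k)
    then show ?thesis by (cases k) (simp_all add: coeff_pderiv)
  qed (simp add: coeff_pderiv)
  have x: "coeff (X * b) m = coeff b m - (if m = 0 then 0 else coeff b (m - 1))"
    unfolding X_def by (cases m) simp_all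
  have y: "coeff (Y * b) m = coeff b m + (if m = 0 then 0 else coeff b (m - 1))"
    unfolding Y_def by (cases m) simp_all
  have "real (m + 1) * coeff b (m + 1) - (if m = 0 then 0 else real (m - 1) * coeff b (m - 1))
    = (real n - real a) * (coeff b m - (if m = 0 then 0 else coeff b (m - 1)))
      - real a * (coeff b m + (if m = 0 then 0 else coeff b (m - 1)))"
    using eq assms unfolding XY l coeff_diff coeff_smult x y by (simp only: of_nat_diff)
  then show ?thesis unfolding b_def[symmetric]
    by (cases m) (simp_all add: algebra_simps)
qed

section \<open>Krawtchouk values as terminating hypergeometric sums\<close>

text \<open>Passing from \<open>i\<close> to \<open>i + 1\<close> multiplies the left side by
  \<open>(m - i) / (n - i)\<close>, which is the absorption identity on the right. The factor is 0
  at \<open>i = m\<close>, and the value stays 0 from there on.\<close>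

lemma binomial_pochhammer_ratio:
  assumes "i \<le> n" "m \<le> n"
  shows "real (n choose m) * pochhammer (- real m) i / pochhammer (- real n) i
    = (if i \<le> m then real ((n - i) choose (m - i)) else 0)"
  using assms
proof (induction i)
  case (Suc i)
  have "- real n + real i \<noteq> 0" using Suc.prems by simp
  then have "real (n choose m) * pochhammer (- real m) (Suc i) / pochhammer (- real n) (Suc i)
     = real (n choose m) * pochhammer (- real m) i / pochhammer (- real n) i
        * ((real m - real i) / (real n - real i))"
    by (simp add: pochhammer_rec' divide_simps) (simp add: algebra_simps)
  also have "\<dots> = (if i \<le> m then real ((n - i) choose (m - i)) else 0) * ((real m - real i) / (real n - real i))"
    using Suc by simp
  also have "\<dots> = (if Suc i \<le> m then real ((n - Suc i) choose (m - Suc i)) else 0)"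
  proof (cases "Suc i \<le> m")
    case True
    have "Suc (m - Suc i) * ((n - i) choose Suc (m - Suc i)) = (n - i) * ((n - i - 1) choose (m - Suc i))"
      by (rule binomial_absorption)
    moreover have "Suc (m - Suc i) = m - i" using True by simp
    ultimately have "(m - i) * ((n - i) choose (m - i)) = (n - i) * ((n - Suc i) choose (m - Suc i))"
      by simp
    then have "real (m - i) * real ((n - i) choose (m - i)) = real (n - i) * real ((n - Suc i) choose (m - Suc i))"
      by (metis of_nat_mult)
    then show ?thesis using True Suc.prems by (simp add: of_nat_diff field_simps)
  next
    case False
    then have "i = m \<or> \<not> i \<le> m" by auto
    then show ?thesis using False by auto
  qed
  finally show ?case .
qed simp

text \<open>Expanding \<open>1 - z\<close> as \<open>(1 + z) - 2z\<close> inside the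
  \<open>a\<close>-th power leaves powers of \<open>1 + z\<close> shifted by \<open>z ^ i\<close>.
  The 2 is the argument of the series, and the sign is absorbed by
  \<open>pochhammer (- real a) i\<close>.\<close>

lemma krawtchouk_gf_hypergeometric:
  assumes "a \<le> n" "m \<le> n"
  shows "coeff (krawtchouk_gf n a) m = real (n choose m) *
    (\<Sum>i=0..a. pochhammer (- real a) i * pochhammer (- real m) i /
        (pochhammer (- real n) i * fact i) * 2 ^ i)"
proof -
  define Y where "Y = [:1, 1 :: real:]"
  have "[:1, -1:] = monom (-2) 1 + Y" by (simp add: Y_def monom_altdef)
  then have "krawtchouk_gf n a = (monom (-2) 1 + Y) ^ a * Y ^ (n - a)"
    unfolding krawtchouk_gf_def Y_def by simp
  also have "\<dots> = (\<Sum>i\<le>a. of_nat (a choose i) * monom (-2) 1 ^ i * Y ^ (a - i)) * Y ^ (n - a)"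
    by (subst binomial_ring) (rule refl)
  also have "\<dots> = (\<Sum>i\<le>a. smult (real (a choose i)) (monom ((-2) ^ i) i * Y ^ (n - i)))"
    unfolding sum_distrib_right
  proof (intro sum.cong refl)
    fix i assume "i \<in> {..a}"
    then have "Y ^ (a - i) * Y ^ (n - a) = Y ^ (n - i)"
      using assms by (simp add: power_add[symmetric])
    moreover have "monom (-2 :: real) 1 ^ i = monom ((-2) ^ i) (i :: nat)" by (simp add: monom_power)
    moreover have "of_nat (a choose i) * p = smult (real (a choose i)) p" for p :: "real poly"
      by (simp add: of_nat_poly)
    ultimately show "of_nat (a choose i) * monom (-2) 1 ^ i * Y ^ (a - i) * Y ^ (n - a)
       = smult (real (a choose i)) (monom ((-2) ^ i) i * Y ^ (n - i))"
      by (simp only: mult.assoc mult_smult_left)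
  qed
  finally have "coeff (krawtchouk_gf n a) m
    = (\<Sum>i\<le>a. real (a choose i) * (if i \<le> m then (-2) ^ i * coeff (Y ^ (n - i)) (m - i) else 0))"
    by (auto simp: coeff_sum coeff_monom_mult intro!: sum.cong)
  also have "\<dots> = (\<Sum>i\<le>a. real (n choose m) * (pochhammer (- real a) i * pochhammer (- real m) i /
        (pochhammer (- real n) i * fact i) * 2 ^ i))"
  proof (intro sum.cong refl)
    fix i assume i: "i \<in> {..a}"
    have 1: "pochhammer (- real a) i / fact i = (-1) ^ i * real (a choose i)"
      by (simp add: binomial_gbinomial gbinomial_pochhammer)
    have 2: "(if i \<le> m then (-2) ^ i * coeff (Y ^ (n - i)) (m - i) else 0)
      = (-2) ^ i * (real (n choose m) * pochhammer (- real m) i / pochhammer (- real n) i)"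
      using assms i unfolding Y_def
      by (subst binomial_pochhammer_ratio) (auto simp: coeff_linear_poly_power)
    have "real (n choose m) * (pochhammer (- real a) i * pochhammer (- real m) i /
        (pochhammer (- real n) i * fact i) * 2 ^ i)
      = pochhammer (- real a) i / fact i * 2 ^ i * (real (n choose m) * pochhammer (- real m) i / pochhammer (- real n) i)"
      by (simp add: mult_ac)
    also have "\<dots> = real (a choose i) * ((-2) ^ i * (real (n choose m) * pochhammer (- real m) i / pochhammer (- real n) i))"
      unfolding 1 by (simp add: power_minus[of 2])
    finally show "real (a choose i) * (if i \<le> m then (-2) ^ i * coeff (Y ^ (n - i)) (m - i) else 0)
      = real (n choose m) * (pochhammer (- real a) i * pochhammer (- real m) i /
        (pochhammer (- real n) i * fact i) * 2 ^ i)"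
      unfolding 2 by simp
  qed
  finally show ?thesis by (simp add: sum_distrib_left atLeast0AtMost)
qed

text \<open>The upper parameter \<open>- N + r\<close> is \<open>- (N - r)\<close>, so the position
  is \<open>N - r\<close>, that is level \<open>r\<close> counted from the top; binomial symmetry
  turns \<open>N - r\<close> into \<open>N + r\<close>.\<close>

lemma theta1_krawtchouk_00:
  assumes "r \<le> N" "a \<le> 2 * N"
  shows "real ((2*N) choose (N+r)) * theta1 N r a 0 0 = coeff (krawtchouk_gf (2 * N) a) (N - r)"
proof -
  have "(2*N) choose (N+r) = (2*N) choose (N - r)"
    using binomial_symmetric[of "N + r" "2 * N"] assms(1) by simp
  then show ?thesis
    using assms by (simp add: krawtchouk_gf_hypergeometric theta1_def of_nat_diff)
qed

lemma theta1_krawtchouk_01: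
  assumes "r \<ge> 1" "r \<le> N" "a \<le> 2 * N - 1"
  shows "real ((2*N-1) choose (N+r-1)) * theta1 N r a 0 1 = coeff (krawtchouk_gf (2 * N - 1) a) (N - r)"
proof -
  have "(2*N-1) choose (N+r-1) = (2*N-1) choose (N - r)"
    using binomial_symmetric[of "N + r - 1" "2 * N - 1"] assms(1,2) by simp
  moreover have "- real (2 * N - 1) = - 2 * real N + 1" using assms(1,2) by (simp add: of_nat_diff)
  moreover have "- real (N - r) = - real N + real r + 0" using assms(2) by (simp add: of_nat_diff)
  ultimately show ?thesis
    using assms krawtchouk_gf_hypergeometric[of a "2 * N - 1" "N - r"] unfolding theta1_def by simp
qed

text \<open>At \<open>r = N\<close> there is no position \<open>N - r - 1\<close>, and the second
  upper parameter of \<open>theta1\<close> becomes 1; the vanishing binomial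
  \<open>(2N - 1) choose 2N\<close> settles this case.\<close>

lemma theta1_krawtchouk_11:
  assumes "r \<ge> 1" "r \<le> N" "a \<le> 2 * N - 1"
  shows "real ((2*N-1) choose (N+r)) * theta1 N r a 1 1
    = (if r = N then 0 else coeff (krawtchouk_gf (2 * N - 1) a) (N - r - 1))"
proof (cases "r = N")
  case True
  then show ?thesis using assms by (simp add: binomial_eq_0)
next
  case False
  have "(2*N-1) choose (N+r) = (2*N-1) choose (N - r - 1)"
    using binomial_symmetric[of "N + r" "2 * N - 1"] assms(1,2) False by simp
  moreover have "- real (2 * N - 1) = - 2 * real N + 1" using assms(1,2) by (simp add: of_nat_diff)
  moreover have "- real (N - r - 1) = - real N + real r + 1" using assms(2) False by (simp add: of_nat_diff)
  ultimately have "real ((2*N-1) choose (N+r)) * theta1 N r a 1 1 = coeff (krawtchouk_gf (2 * N - 1) a) (N - r - 1)"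
    using assms krawtchouk_gf_hypergeometric[of a "2 * N - 1" "N - r - 1"] unfolding theta1_def
    by (simp only:)
  then show ?thesis using False by simp
qed

section \<open>Initial state and sources expanded in Krawtchouk eigenvectors\<close>

text \<open>The \<open>N\<close>-th power of \<open>(1 + z)^2 - (1 - z)^2 = 4z\<close>. Position
  \<open>N\<close> is level 0, so this represents both the initial state and the constant
  catastrophe source.\<close>

lemma monom_krawtchouk_expansion:
  "(\<Sum>l\<le>N. smult (real (N choose l) * (-1) ^ l) (krawtchouk_gf (2 * N) (2 * l))) = monom (4 ^ N) N"
proof -
  define X where "X = [:1, -1 :: real:]"
  define Y where "Y = [:1, 1 :: real:]"
  have XY: "- X\<^sup>2 + Y\<^sup>2 = monom 4 1" by (simp add: X_def Y_def power2_eq_square monom_altdef)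
  have "monom (4 ^ N) N = (- X\<^sup>2 + Y\<^sup>2) ^ N" unfolding XY by (simp add: monom_power)
  also have "\<dots> = (\<Sum>l\<le>N. of_nat (N choose l) * (- X\<^sup>2) ^ l * (Y\<^sup>2) ^ (N - l))"
    by (rule binomial_ring)
  also have "\<dots> = (\<Sum>l\<le>N. smult (real (N choose l) * (-1) ^ l) (krawtchouk_gf (2 * N) (2 * l)))"
  proof (intro sum.cong refl)
    fix l assume "l \<in> {..N}"
    have "- X\<^sup>2 = smult (-1) (X\<^sup>2)" by simp
    then have "(- X\<^sup>2) ^ l = smult ((-1) ^ l) (X ^ (2 * l))"
      by (simp only: smult_power power_mult)
    moreover have "(Y\<^sup>2) ^ (N - l) = Y ^ (2 * N - 2 * l)"
      by (simp add: power_mult[symmetric] diff_mult_distrib2)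
    moreover have "of_nat (N choose l) * p = smult (real (N choose l)) p" for p :: "real poly"
      by (simp add: of_nat_poly)
    ultimately show "of_nat (N choose l) * (- X\<^sup>2) ^ l * (Y\<^sup>2) ^ (N - l)
      = smult (real (N choose l) * (-1) ^ l) (krawtchouk_gf (2 * N) (2 * l))"
      unfolding krawtchouk_gf_def X_def[symmetric] Y_def[symmetric] by (simp add: mult.commute[of "(-1) ^ l" "real (N choose l)"])
  qed
  finally show ?thesis by simp
qed

text \<open>The identity \<open>(1 - z)(1 + z) - (1 - z)^2 = 2z(1 - z)\<close> times the preceding
  expansion for \<open>N - 1\<close>. The two members of each difference become the two double sums
  of the final formula. All indices are at least 1, which keeps the eigenvalues away from the root
  0.\<close>

lemma monom_diff_krawtchouk_expansion:
  assumes "N \<ge> 1"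
  shows "(\<Sum>j\<le>N-1. smult (real ((N - 1) choose j) * (-1) ^ (N - 1 - j))
      (krawtchouk_gf (2 * N) (2 * N - 2 * j - 1) - krawtchouk_gf (2 * N) (2 * N - 2 * j)))
    = smult (2 * 4 ^ (N - 1)) (monom 1 N - monom 1 (N + 1))"
proof -
  define X where "X = [:1, -1 :: real:]"
  define Y where "Y = [:1, 1 :: real:]"
  define n where "n = N - 1"
  have N: "N = Suc n" using assms by (simp add: n_def)
  have XY: "X * Y - X\<^sup>2 = smult 2 (monom 1 1 - monom 1 2)"
    by (simp add: X_def Y_def power2_eq_square monom_altdef)
  \<comment> \<open>The exponent of \<open>X\<close> belonging to \<open>j\<close> is governed by
    \<open>n - j\<close>, so the expansion for \<open>N - 1\<close> fits after reversing the
    summation.\<close>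
  have flip: "(\<Sum>j\<le>n. f (n - j)) = (\<Sum>j\<le>n. f j)" for f :: "nat \<Rightarrow> real poly"
    using sum.nat_diff_reindex[of f "Suc n"] by (simp add: lessThan_Suc_atMost)
  have "(\<Sum>j\<le>n. smult (real (n choose j) * (-1) ^ (n - j))
      (krawtchouk_gf (2 * N) (2 * N - 2 * j - 1) - krawtchouk_gf (2 * N) (2 * N - 2 * j)))
    = (\<Sum>j\<le>n. smult (real (n choose (n - j)) * (-1) ^ (n - j))
      ((X * Y - X\<^sup>2) * krawtchouk_gf (2 * n) (2 * (n - j))))"
  proof (intro sum.cong refl)
    fix j assume "j \<in> {..n}"
    then have j: "j \<le> n" by simp
    have a: "2 * N - 2 * j - 1 = 2 * (n - j) + 1" "2 * N - 2 * j = 2 * (n - j) + 2"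
      "2 * N - (2 * (n - j) + 1) = 2 * j + 1" "2 * N - (2 * (n - j) + 2) = 2 * j"
      "2 * n - 2 * (n - j) = 2 * j"
      using j N by auto
    have "krawtchouk_gf (2 * N) (2 * N - 2 * j - 1) - krawtchouk_gf (2 * N) (2 * N - 2 * j)
      = (X * Y - X\<^sup>2) * krawtchouk_gf (2 * n) (2 * (n - j))"
    proof -
      have "krawtchouk_gf (2 * N) (2 * N - 2 * j - 1) = X ^ (2 * (n - j) + 1) * Y ^ (2 * j + 1)"
        unfolding a(1) krawtchouk_gf_def a(3) X_def Y_def by (rule refl)
      moreover have "krawtchouk_gf (2 * N) (2 * N - 2 * j) = X ^ (2 * (n - j) + 2) * Y ^ (2 * j)"
        unfolding a(2) krawtchouk_gf_def a(4) X_def Y_def by (rule refl)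
      moreover have "krawtchouk_gf (2 * n) (2 * (n - j)) = X ^ (2 * (n - j)) * Y ^ (2 * j)"
        unfolding krawtchouk_gf_def a(5) X_def Y_def by (rule refl)
      ultimately show ?thesis
        by (simp add: power_add power2_eq_square left_diff_distrib mult_ac)
    qed
    then show "smult (real (n choose j) * (-1) ^ (n - j))
      (krawtchouk_gf (2 * N) (2 * N - 2 * j - 1) - krawtchouk_gf (2 * N) (2 * N - 2 * j))
      = smult (real (n choose (n - j)) * (-1) ^ (n - j))
      ((X * Y - X\<^sup>2) * krawtchouk_gf (2 * n) (2 * (n - j)))"
      using binomial_symmetric[OF j] by simp
  qed
  also have "\<dots> = (\<Sum>l\<le>n. smult (real (n choose l) * (-1) ^ l) ((X * Y - X\<^sup>2) * krawtchouk_gf (2 * n) (2 * l)))"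
    by (rule flip)
  also have "\<dots> = (X * Y - X\<^sup>2) * (\<Sum>l\<le>n. smult (real (n choose l) * (-1) ^ l) (krawtchouk_gf (2 * n) (2 * l)))"
    by (simp add: sum_distrib_left)
  also have "\<dots> = smult (2 * 4 ^ n) (monom 1 N - monom 1 (N + 1))"
    unfolding monom_krawtchouk_expansion XY N
    by (simp add: left_diff_distrib mult_monom smult_monom smult_diff_right)
  finally show ?thesis by (simp add: n_def)
qed

section \<open>Lagrange interpolation and Krawtchouk polynomials\<close>

text \<open>Compare the coefficients of degree \<open>n\<close> in the interpolation formula: every
  basis polynomial is monic before division by its denominator. For a polynomial of degree below
  \<open>n\<close> the sum is 0, which later empties all levels except 0 at time 0.\<close>

lemma lagrange_leading_coefficient:
  fixes x :: "'i \<Rightarrow> real"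
  assumes "finite I" "inj_on x I" "card I = n + 1" "degree f \<le> n"
  shows "(\<Sum>i\<in>I. poly f (x i) / (\<Prod>s\<in>I-{i}. x i - x s)) = coeff f n"
proof -
  define B where "B i = (\<Prod>s\<in>I-{i}. [:- x s, 1:])" for i
  define D where "D i = (\<Prod>s\<in>I-{i}. x i - x s)" for i
  define L where "L = (\<Sum>i\<in>I. smult (poly f (x i) / D i) (B i))"
  have degB: "degree (B i) = n" if "i \<in> I" for i
    unfolding B_def using assms(1,3) that by (subst degree_prod_sum_eq) auto
  have leadB: "coeff (B i) n = 1" if "i \<in> I" for i
    using lead_coeff_prod[of "\<lambda>s. [:- x s, 1:]" "I - {i}"] degB[OF that] by (simp add: B_def)
  have polyB: "poly (B i) (x j) = (if i = j then D j else 0)" if "i \<in> I" "j \<in> I" for i j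
    using that assms(1) by (auto simp: B_def D_def poly_prod prod_zero_iff)
  have D: "D i \<noteq> 0" if "i \<in> I" for i
    using that assms(1,2) by (auto simp: D_def prod_zero_iff inj_on_def)
  have "L = f"
  proof (rule poly_eqI_degree[of "x ` I"])
    fix y assume "y \<in> x ` I"
    then obtain j where j: "j \<in> I" "y = x j" by auto
    have "poly L y = (\<Sum>i\<in>I. if i = j then poly f (x j) else 0)"
      unfolding L_def poly_sum using D polyB j by (intro sum.cong) auto
    then show "poly L y = poly f y" using j assms(1) by (simp add: sum.delta)
  next
    have "degree L \<le> n"
      unfolding L_def using degB by (intro degree_sum_le assms(1)) (auto intro: degree_smult_le[THEN order_trans])
    then show "card (x ` I) > degree L" using assms by (simp add: card_image)
    show "card (x ` I) > degree f" using assms by (simp add: card_image)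
  qed
  then have "coeff f n = coeff L n" by simp
  also have "\<dots> = (\<Sum>i\<in>I. poly f (x i) / D i)"
    unfolding L_def coeff_sum using leadB by (intro sum.cong) auto
  finally show ?thesis by (simp add: D_def)
qed

text \<open>\<open>krawtchouk_poly mu N m\<close> is the polynomial in the eigenvalue \<open>x\<close> whose value at
  \<open>x = - 2 * mu * a\<close> is the \<open>m\<close>-th coefficient of \<open>krawtchouk_gf (2 * N) a\<close>.\<close>

fun krawtchouk_poly :: "real \<Rightarrow> nat \<Rightarrow> nat \<Rightarrow> real poly" where
  "krawtchouk_poly mu N 0 = 1"
| "krawtchouk_poly mu N (Suc 0) = smult (1 / mu) [:2 * mu * real N, 1:]"
| "krawtchouk_poly mu N (Suc (Suc m)) = smult (1 / (mu * (real m + 2)))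
     ([:2 * mu * real N, 1:] * krawtchouk_poly mu N (Suc m)
       - smult (mu * (2 * real N - real m)) (krawtchouk_poly mu N m))"

lemma krawtchouk_poly_recurrence:
  assumes "mu > 0"
  shows "mu * (real m + 1) * poly (krawtchouk_poly mu N (m + 1)) x
    + (if m = 0 then 0 else mu * (2 * real N - real m + 1) * poly (krawtchouk_poly mu N (m - 1)) x)
    = (x + 2 * mu * real N) * poly (krawtchouk_poly mu N m) x"
proof (cases m)
  case 0
  then show ?thesis using assms by (simp add: field_simps)
next
  case (Suc k)
  have "mu * (real k + 2) \<noteq> 0" using assms by simp
  then show ?thesis using Suc by (simp add: field_simps)
qed

lemma degree_krawtchouk_poly: "degree (krawtchouk_poly mu N m) \<le> m"
proof (induction m rule: less_induct)
  case (less m)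
  consider "m = 0" | "m = 1" | k where "m = Suc (Suc k)"
    by (metis One_nat_def not0_implies_Suc)
  then show ?case
  proof cases
    case 2
    then show ?thesis by simp
  next
    case 3
    have "degree ([:2 * mu * real N, 1:] * krawtchouk_poly mu N (Suc k)) \<le> Suc (Suc k)"
      using less[of "Suc k"] 3 by (intro degree_mult_le[THEN order_trans]) auto
    moreover have "degree (smult (mu * (2 * real N - real k)) (krawtchouk_poly mu N k)) \<le> Suc (Suc k)"
      using less[of k] 3 by (intro degree_smult_le[THEN order_trans]) auto
    ultimately show ?thesis unfolding 3 krawtchouk_poly.simps
      using degree_diff_le degree_smult_le order_trans by blast
  qed simp
qed

lemma coeff_krawtchouk_poly:
  assumes "mu > 0"
  shows "coeff (krawtchouk_poly mu N m) m = 1 / (mu ^ m * fact m)"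
proof (induction m rule: less_induct)
  case (less m)
  consider "m = 0" | "m = 1" | k where "m = Suc (Suc k)"
    by (metis One_nat_def not0_implies_Suc)
  then show ?case
  proof cases
    case 3
    have z: "coeff (krawtchouk_poly mu N (Suc k)) (Suc (Suc k)) = 0"
      "coeff (krawtchouk_poly mu N k) (Suc (Suc k)) = 0"
      using degree_krawtchouk_poly by (auto intro!: coeff_eq_0 simp: less_Suc_eq_le le_SucI)
    show ?thesis unfolding 3 krawtchouk_poly.simps using less[of "Suc k"] 3 assms z
      by (simp add: field_simps)
  qed simp_all
qed

text \<open>Both sides start at 1 and obey the same three-term recurrence once the eigenvalue is
  inserted.\<close>

lemma krawtchouk_poly_eigenvalue:
  assumes "mu > 0" "a \<le> 2 * N"
  shows "poly (krawtchouk_poly mu N m) (- 2 * mu * real a) = coeff (krawtchouk_gf (2 * N) a) m"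
proof (induction m rule: less_induct)
  case (less m)
  show ?case
  proof (cases m)
    case 0
    then show ?thesis by (simp add: krawtchouk_gf_0)
  next
    case (Suc k)
    define b where "b = coeff (krawtchouk_gf (2 * N) a)"
    define K where "K m = poly (krawtchouk_poly mu N m) (- 2 * mu * real a)" for m
    have IH: "K k = b k" "k \<noteq> 0 \<Longrightarrow> K (k - 1) = b (k - 1)"
      using less[of k] less[of "k - 1"] Suc by (auto simp: K_def b_def)
    define d where "d = (if k = 0 then 0 else (2 * real N - real k + 1) * b (k - 1))"
    have "mu * (real k + 1) * K (k + 1) + (if k = 0 then 0 else mu * (2 * real N - real k + 1) * K (k - 1))
      = (- 2 * mu * real a + 2 * mu * real N) * K k"
      unfolding K_def by (rule krawtchouk_poly_recurrence[OF assms(1)])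
    moreover have "(if k = 0 then 0 else mu * (2 * real N - real k + 1) * K (k - 1)) = mu * d"
      using IH(2) by (simp add: d_def)
    ultimately have 1: "mu * (real k + 1) * K (k + 1) + mu * d = (- 2 * mu * real a + 2 * mu * real N) * b k"
      using IH(1) by simp
    have 2: "(real k + 1) * b (k + 1) + d = (2 * real N - 2 * real a) * b k"
      using krawtchouk_gf_recurrence[OF assms(2), of k] unfolding b_def d_def
      by (cases "k = 0") (simp_all add: add.commute)
    have "mu * (real k + 1) * K (k + 1) = mu * (real k + 1) * b (k + 1)"
      using 1 2 by algebra
    then have "K (k + 1) = b (k + 1)" using assms(1) by simp
    then show ?thesis using Suc by (simp add: K_def b_def)
  qed
qed

text \<open>The scaling makes the polynomial monic. At \<open>- 2 * mu * (2r + 1)\<close> its value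
  is a multiple of the middle coefficient for an odd index, which reflection forces to be 0; these
  \<open>N\<close> zeros and the leading coefficient determine it.\<close>

lemma prod_odd_krawtchouk:
  assumes "mu > 0"
  shows "smult (mu ^ N * fact N) (krawtchouk_poly mu N N) = (\<Prod>r<N. [:2 * mu * (2 * real r + 1), 1:])"
proof (rule poly_eqI_degree_lead_coeff[of _ N _ "(\<lambda>r. - 2 * mu * real (2 * r + 1)) ` {..<N}"])
  have deg: "degree (\<Prod>r<N. [:2 * mu * (2 * real r + 1), 1:]) = N"
    by (subst degree_prod_sum_eq) auto
  show "degree (\<Prod>r<N. [:2 * mu * (2 * real r + 1), 1:]) \<le> N" unfolding deg by simp
  show "degree (smult (mu ^ N * fact N) (krawtchouk_poly mu N N)) \<le> N"
    using degree_krawtchouk_poly by (intro degree_smult_le[THEN order_trans])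
  have "coeff (\<Prod>r<N. [:2 * mu * (2 * real r + 1), 1:]) N = 1"
    using lead_coeff_prod[of "\<lambda>r. [:2 * mu * (2 * real r + 1), 1:]" "{..<N}"] deg by simp
  then show "coeff (smult (mu ^ N * fact N) (krawtchouk_poly mu N N)) N
    = coeff (\<Prod>r<N. [:2 * mu * (2 * real r + 1), 1:]) N"
    using assms by (simp add: coeff_krawtchouk_poly)
  have "inj_on (\<lambda>r. - 2 * mu * real (2 * r + 1)) {..<N}" using assms by (auto simp: inj_on_def)
  then show "N \<le> card ((\<lambda>r. - 2 * mu * real (2 * r + 1)) ` {..<N})" by (simp add: card_image)
  fix z assume "z \<in> (\<lambda>r. - 2 * mu * real (2 * r + 1)) ` {..<N}"
  then obtain r where r: "r < N" "z = - 2 * mu * real (2 * r + 1)" by auto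
  have "coeff (krawtchouk_gf (2 * N) (2 * r + 1)) N = - coeff (krawtchouk_gf (2 * N) (2 * r + 1)) N"
    using krawtchouk_gf_reflect[of "2 * r + 1" "2 * N" N] r by simp
  then have "poly (krawtchouk_poly mu N N) z = 0"
    unfolding r(2) using r(1) assms by (subst krawtchouk_poly_eigenvalue) auto
  moreover have "poly (\<Prod>r<N. [:2 * mu * (2 * real r + 1), 1:]) z = 0"
    unfolding poly_prod using r by (intro prod_zero) (auto intro!: bexI[of _ r] simp: algebra_simps)
  ultimately show "poly (smult (mu ^ N * fact N) (krawtchouk_poly mu N N)) z
    = poly (\<Prod>r<N. [:2 * mu * (2 * real r + 1), 1:]) z" by simp
qed

text \<open>The bracket is the eigenvalue equation of the level process at level 0. At the
  \<open>N + 1\<close> even points \<open>- 4 * mu * i\<close>, reflection equates positions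
  \<open>N - 1\<close> and \<open>N + 1\<close>, so the recurrence can be halved and the left side
  becomes \<open>z / 2\<close> times the odd product. The even product contributes nothing there;
  the leading coefficient completes the comparison in degree \<open>N + 1\<close>.\<close>

lemma char_poly_P_krawtchouk:
  assumes mu: "mu > 0" and N: "N \<ge> 1"
  shows "smult (mu ^ N * fact N) ([:mu * real N, 1:] * krawtchouk_poly mu N N
      - smult (mu * (real N + 1)) (krawtchouk_poly mu N (N - 1)))
    = smult (1 / 2) (char_poly_P N mu)"
proof (rule poly_eqI_degree_lead_coeff[of _ "N + 1" _ "(\<lambda>i. - 2 * mu * real (2 * i)) ` {..N}"])
  let ?c = "mu ^ N * fact N"
  define Od where "Od = (\<Prod>r<N. [:2 * mu * (2 * real r + 1), 1:])"
  define Ev where "Ev = (\<Prod>r<N. [:2 * mu * (2 * real r + 2), 1:])"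
  have degs: "degree Od = N" "degree Ev = N"
    unfolding Od_def Ev_def by (subst degree_prod_sum_eq; simp)+
  have leads: "coeff Od N = 1" "coeff Ev N = 1"
    using lead_coeff_prod[of "\<lambda>r. [:2 * mu * (2 * real r + 1), 1:]" "{..<N}"]
      lead_coeff_prod[of "\<lambda>r. [:2 * mu * (2 * real r + 2), 1:]" "{..<N}"] degs
    by (simp_all add: Od_def Ev_def)
  have P: "char_poly_P N mu = pCons 0 (Od + Ev)"
    unfolding char_poly_P_def Od_def[symmetric] Ev_def[symmetric] by simp
  have dOE: "degree (Od + Ev) \<le> N" using degs by (intro degree_add_le) auto
  show "degree (smult (1 / 2) (char_poly_P N mu)) \<le> N + 1"
    unfolding P using dOE by (intro degree_smult_le[THEN order_trans]) (auto simp: degree_pCons_eq_if)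
  have e: "smult ?c ([:mu * real N, 1:] * krawtchouk_poly mu N N
      - smult (mu * (real N + 1)) (krawtchouk_poly mu N (N - 1)))
    = [:mu * real N, 1:] * Od - smult (?c * (mu * (real N + 1))) (krawtchouk_poly mu N (N - 1))"
    unfolding Od_def prod_odd_krawtchouk[OF mu, symmetric] by (simp add: smult_diff_right mult_smult_right)
  have dK: "degree (krawtchouk_poly mu N (N - 1)) \<le> N - 1" by (rule degree_krawtchouk_poly)
  show "degree (smult ?c ([:mu * real N, 1:] * krawtchouk_poly mu N N
      - smult (mu * (real N + 1)) (krawtchouk_poly mu N (N - 1)))) \<le> N + 1"
    unfolding e
  proof (intro degree_diff_le)
    show "degree ([:mu * real N, 1:] * Od) \<le> N + 1"
      using degs degree_mult_le[of "[:mu * real N, 1:]" Od] by simp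
    show "degree (smult (?c * (mu * (real N + 1))) (krawtchouk_poly mu N (N - 1))) \<le> N + 1"
      using dK by (intro degree_smult_le[THEN order_trans]) linarith
  qed
  show "coeff (smult ?c ([:mu * real N, 1:] * krawtchouk_poly mu N N
      - smult (mu * (real N + 1)) (krawtchouk_poly mu N (N - 1)))) (N + 1)
    = coeff (smult (1 / 2) (char_poly_P N mu)) (N + 1)"
    unfolding e P using leads degs dK by (simp add: coeff_eq_0)
  have "inj_on (\<lambda>i. - 2 * mu * real (2 * i)) {..N}" using mu by (auto simp: inj_on_def)
  then show "N + 1 \<le> card ((\<lambda>i. - 2 * mu * real (2 * i)) ` {..N})" by (simp add: card_image)
  fix z assume "z \<in> (\<lambda>i. - 2 * mu * real (2 * i)) ` {..N}"
  then obtain i where i: "i \<le> N" "z = - 2 * mu * real (2 * i)" by auto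
  have rec: "mu * (real N + 1) * poly (krawtchouk_poly mu N (N + 1)) z
    + mu * (real N + 1) * poly (krawtchouk_poly mu N (N - 1)) z
    = (z + 2 * mu * real N) * poly (krawtchouk_poly mu N N) z"
    using krawtchouk_poly_recurrence[OF mu, of N N z] N by (simp add: algebra_simps)
  have "coeff (krawtchouk_gf (2 * N) (2 * i)) (N - 1) = coeff (krawtchouk_gf (2 * N) (2 * i)) (N + 1)"
  proof -
    have "2 * N - (N + 1) = N - 1" by simp
    then show ?thesis using krawtchouk_gf_reflect[of "2 * i" "2 * N" "N + 1"] i N by simp
  qed
  then have "poly (krawtchouk_poly mu N (N - 1)) z = poly (krawtchouk_poly mu N (N + 1)) z"
    unfolding i(2) using i(1) krawtchouk_poly_eigenvalue[OF mu, of "2 * i" N] by simp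
  with rec have k: "mu * (real N + 1) * poly (krawtchouk_poly mu N (N - 1)) z
    = (z / 2 + mu * real N) * poly (krawtchouk_poly mu N N) z"
    by (simp add: algebra_simps)
  \<comment> \<open>For \<open>i = 0\<close> the factor \<open>z\<close> vanishes, otherwise the
    factor of \<open>Ev\<close> with \<open>r = i - 1\<close> does.\<close>
  have zE: "z * poly Ev z = 0"
  proof (cases i)
    case (Suc r)
    then have "poly Ev z = 0" unfolding Ev_def poly_prod using i
      by (intro prod_zero) (auto intro!: bexI[of _ r] simp: algebra_simps)
    then show ?thesis by simp
  qed (use i in simp)
  have Od: "poly Od z = ?c * poly (krawtchouk_poly mu N N) z"
    unfolding Od_def prod_odd_krawtchouk[OF mu, symmetric] by simp
  have "poly (smult ?c ([:mu * real N, 1:] * krawtchouk_poly mu N N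
      - smult (mu * (real N + 1)) (krawtchouk_poly mu N (N - 1)))) z
    = ?c * ((mu * real N + z) * poly (krawtchouk_poly mu N N) z
       - mu * (real N + 1) * poly (krawtchouk_poly mu N (N - 1)) z)"
    by (simp add: algebra_simps)
  also have "\<dots> = z / 2 * (?c * poly (krawtchouk_poly mu N N) z)"
    unfolding k by (simp add: algebra_simps)
  also have "\<dots> = 1 / 2 * (z * poly Od z + z * poly Ev z)" unfolding zE Od by simp
  also have "\<dots> = poly (smult (1 / 2) (char_poly_P N mu)) z"
    unfolding P by (simp add: algebra_simps)
  finally show "poly (smult ?c ([:mu * real N, 1:] * krawtchouk_poly mu N N
      - smult (mu * (real N + 1)) (krawtchouk_poly mu N (N - 1)))) z
    = poly (smult (1 / 2) (char_poly_P N mu)) z" .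
qed

section \<open>The probability of level 0\<close>

text \<open>\<open>theta2 xi t y\<close> is \<open>y / (xi + y)\<close> times
  \<open>1 - exp (- t * (xi + y))\<close>: the solution of this linear equation that starts at
  0.\<close>

lemma theta2_has_derivative:
  assumes "xi + y \<noteq> 0"
  shows "((\<lambda>t. theta2 xi t y) has_real_derivative y - (xi + y) * theta2 xi t y) (at t within A)"
proof -
  define c where "c = xi + y"
  define K where "K = 1 - xi / c"
  have th: "theta2 xi t y = (1 - exp (- t * c)) * K" for t by (simp add: theta2_def K_def c_def)
  have cK: "c * K = y" using assms by (simp add: K_def c_def field_simps)
  have "((\<lambda>t. (1 - exp (- t * c)) * K) has_real_derivative exp (- t * c) * (c * K)) (at t within A)"
    by (auto intro!: derivative_eq_intros)
  also have "exp (- t * c) * (c * K) = c * K - c * ((1 - exp (- t * c)) * K)"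
    by (simp add: algebra_simps)
  finally show ?thesis unfolding th cK by (simp add: c_def)
qed

section \<open>The roots of P and the coefficients R\<close>

lemma poly_prod_odd: "poly (\<Prod>r<N. [:2 * mu * (2 * real r + 1), 1:]) x = (\<Prod>r<N. x + 2 * mu * (2 * real r + 1))"
  by (simp add: poly_prod add.commute)

text \<open>The factor 2 is the leading coefficient of a sum of two monic products; the
  \<open>N + 1\<close> distinct roots account for the whole degree.\<close>

lemma enumerates_roots_char_poly:
  assumes "enumerates_roots N mu \<alpha>"
  shows "char_poly_P N mu = smult 2 (\<Prod>s=1..N+1. [:- \<alpha> s, 1:])"
proof (rule poly_eqI_degree_lead_coeff[of _ "N + 1" _ "\<alpha> ` {1..N+1}"])
  define Od where "Od = (\<Prod>r<N. [:2 * mu * (2 * real r + 1), 1:])"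
  define Ev where "Ev = (\<Prod>r<N. [:2 * mu * (2 * real r + 2), 1:])"
  have degs: "degree Od = N" "degree Ev = N"
    unfolding Od_def Ev_def by (subst degree_prod_sum_eq; simp)+
  have leads: "coeff Od N = 1" "coeff Ev N = 1"
    using lead_coeff_prod[of "\<lambda>r. [:2 * mu * (2 * real r + 1), 1:]" "{..<N}"]
      lead_coeff_prod[of "\<lambda>r. [:2 * mu * (2 * real r + 2), 1:]" "{..<N}"] degs
    by (simp_all add: Od_def Ev_def)
  have P: "char_poly_P N mu = pCons 0 (Od + Ev)"
    unfolding char_poly_P_def Od_def[symmetric] Ev_def[symmetric] by simp
  have deg: "degree (\<Prod>s=1..N+1. [:- \<alpha> s, 1:]) = N + 1"
    by (subst degree_prod_sum_eq) auto
  have "degree (Od + Ev) \<le> N" using degs by (intro degree_add_le) auto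
  then show "degree (char_poly_P N mu) \<le> N + 1"
    unfolding P by (auto simp: degree_pCons_eq_if)
  show "degree (smult 2 (\<Prod>s=1..N+1. [:- \<alpha> s, 1:])) \<le> N + 1" using deg by simp
  have "coeff (\<Prod>s=1..N+1. [:- \<alpha> s, 1:]) (N + 1) = 1"
    using lead_coeff_prod[of "\<lambda>s. [:- \<alpha> s, 1:]" "{1..N+1}"] deg by simp
  then show "coeff (char_poly_P N mu) (N + 1) = coeff (smult 2 (\<Prod>s=1..N+1. [:- \<alpha> s, 1:])) (N + 1)"
    unfolding P coeff_smult using leads by simp
  have "inj_on \<alpha> {1..N+1}"
    using assms unfolding enumerates_roots_def by (intro linorder_inj_onI) force+
  then show "N + 1 \<le> card (\<alpha> ` {1..N+1})" by (simp add: card_image)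
  fix z assume z: "z \<in> \<alpha> ` {1..N+1}"
  then have "poly (char_poly_P N mu) z = 0" using assms unfolding enumerates_roots_def by auto
  moreover have "poly (\<Prod>s=1..N+1. [:- \<alpha> s, 1:]) z = 0"
    unfolding poly_prod using z by (intro prod_zero) auto
  ultimately show "poly (char_poly_P N mu) z = poly (smult 2 (\<Prod>s=1..N+1. [:- \<alpha> s, 1:])) z" by simp
qed

text \<open>Split \<open>(2N)!\<close> into its odd and even factors, the latter multiplying to
  \<open>2 ^ N * N!\<close>. This gives the ratio of the two products of P at 0.\<close>

lemma prod_odd_even_central_binomial:
  "4 ^ N * (\<Prod>r<N. 2 * real r + 1) = real ((2*N) choose N) * (\<Prod>r<N. 2 * real r + 2)"
proof -
  have f: "fact (2 * N) = (\<Prod>r<N. 2 * real r + 1) * (\<Prod>r<N. 2 * real r + 2)"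
    by (induction N) (simp_all add: algebra_simps)
  have e: "(\<Prod>r<N. 2 * real r + 2) = 2 ^ N * fact N"
    by (induction N) (simp_all add: algebra_simps)
  have "real ((2*N) choose N) = fact (2 * N) / (fact N * fact N)"
    by (simp add: binomial_fact mult_2)
  moreover have "(4::real) ^ N = 2 ^ N * 2 ^ N" by (simp add: power_mult_distrib[symmetric])
  ultimately show ?thesis unfolding f e by (simp add: field_simps)
qed

text \<open>Dividing P by \<open>x\<close> and setting \<open>x = 0\<close> expresses the
  denominator of \<open>R_coeff\<close> as the sum of the odd and the even product at 0.\<close>

lemma R_coeff_first:
  assumes "mu > 0" and er: "enumerates_roots N mu \<alpha>"
  shows "R_coeff N mu \<alpha> 1 = real ((2*N) choose N) / (real ((2*N) choose N) + 4 ^ N)"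
proof -
  define Od where "Od = (\<Prod>r<N. [:2 * mu * (2 * real r + 1), 1:])"
  define Ev where "Ev = (\<Prod>r<N. [:2 * mu * (2 * real r + 2), 1:])"
  define Q where "Q = (\<Prod>s\<in>{1..N+1}-{1}. [:- \<alpha> s, 1:])"
  define D where "D = (\<Prod>s\<in>{1..N+1}-{1}. \<alpha> 1 - \<alpha> s)"
  define C where "C = real ((2*N) choose N)"
  define E0 where "E0 = (\<Prod>r<N. 2 * real r + 2)"
  define O0 where "O0 = (\<Prod>r<N. 2 * real r + 1)"
  have a1: "\<alpha> 1 = 0" using er unfolding enumerates_roots_def by blast
  have "(\<Prod>s=1..N+1. [:- \<alpha> s, 1:]) = [:- \<alpha> 1, 1:] * Q"
    unfolding Q_def by (rule prod.remove) auto
  then have "pCons 0 (Od + Ev) = pCons 0 (smult 2 Q)"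
    using enumerates_roots_char_poly[OF er] a1
    unfolding char_poly_P_def Od_def[symmetric] Ev_def[symmetric] by simp
  then have "poly (Od + Ev) 0 = poly (smult 2 Q) 0" by simp
  moreover have "poly Q 0 = D" unfolding Q_def D_def poly_prod a1 by simp
  moreover have Od0: "poly Od 0 = (2 * mu) ^ N * O0"
    unfolding Od_def O0_def by (simp add: poly_prod prod.distrib)
  moreover have Ev0: "poly Ev 0 = (2 * mu) ^ N * E0"
    unfolding Ev_def E0_def by (simp add: poly_prod prod.distrib)
  ultimately have D: "2 * D = (2 * mu) ^ N * (O0 + E0)" by (simp add: distrib_left)
  have "R_coeff N mu \<alpha> 1 = (2 * mu) ^ N * O0 / (2 * D)"
    unfolding R_coeff_def D_def[symmetric] O0_def using a1 by (simp add: prod.distrib)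
  also have "\<dots> = O0 / (O0 + E0)" unfolding D using assms(1) by simp
  also have "\<dots> = 4 ^ N * O0 / (4 ^ N * (O0 + E0))" by simp
  also have "\<dots> = C * E0 / (C * E0 + 4 ^ N * E0)"
    using prod_odd_even_central_binomial[of N] by (simp add: C_def O0_def E0_def distrib_left)
  also have "\<dots> = E0 * C / (E0 * (C + 4 ^ N))" by (simp add: algebra_simps)
  also have "\<dots> = C / (C + 4 ^ N)"
  proof -
    have "E0 > 0" unfolding E0_def by (intro prod_pos) auto
    then show ?thesis by simp
  qed
  finally show ?thesis by (simp add: C_def)
qed

lemma enumerates_roots_nonpos:
  assumes "enumerates_roots N mu \<alpha>" "k \<in> {1..N+1}"
  shows "\<alpha> k \<le> 0"
proof (cases "k = 1")
  case True
  then show ?thesis using assms(1) unfolding enumerates_roots_def by simp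
next
  case False
  then have "1 < k" using assms(2) by auto
  moreover have "\<forall>i\<in>{1..N+1}. \<forall>j\<in>{1..N+1}. i < j \<longrightarrow> \<alpha> j < \<alpha> i"
    using assms(1) unfolding enumerates_roots_def by blast
  ultimately have "\<alpha> k < \<alpha> 1" using assms(2) by auto
  then show ?thesis using assms(1) unfolding enumerates_roots_def by simp
qed

text \<open>Excludes resonance: at \<open>- 2 * mu * a\<close> exactly one of the two products in P
  vanishes, depending on the parity of \<open>a\<close>, so P is nonzero there. The denominators of
  the final formula are thus nonzero.\<close>

lemma enumerates_roots_avoid:
  assumes "mu > 0" "enumerates_roots N mu \<alpha>" "k \<in> {1..N+1}" "1 \<le> a" "a \<le> 2 * N"
  shows "\<bar>\<alpha> k\<bar> \<noteq> 2 * mu * real a"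
proof
  define x where "x = - 2 * mu * real a"
  assume "\<bar>\<alpha> k\<bar> = 2 * mu * real a"
  then have ax: "\<alpha> k = x" using enumerates_roots_nonpos[OF assms(2,3)] by (simp add: x_def)
  have "x \<noteq> 0" using assms by (simp add: x_def)
  have "poly (char_poly_P N mu) x = 0"
    using assms(2,3) ax unfolding enumerates_roots_def by blast
  then have z: "(\<Prod>r<N. x + 2 * mu * (2 * real r + 1)) + (\<Prod>r<N. x + 2 * mu * (2 * real r + 2)) = 0"
    using \<open>x \<noteq> 0\<close> by (simp add: char_poly_P_def poly_prod add.commute)
  have f1: "x + 2 * mu * (2 * real r + 1) = 0 \<longleftrightarrow> a = 2 * r + 1" for r
  proof -
    have "x + 2 * mu * (2 * real r + 1) = 2 * mu * (real (2 * r + 1) - real a)"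
      by (simp add: x_def algebra_simps)
    then show ?thesis using assms(1) by auto
  qed
  have f2: "x + 2 * mu * (2 * real r + 2) = 0 \<longleftrightarrow> a = 2 * r + 2" for r
  proof -
    have "x + 2 * mu * (2 * real r + 2) = 2 * mu * (real (2 * r + 2) - real a)"
      by (simp add: x_def algebra_simps)
    then show ?thesis using assms(1) by auto
  qed
  show False
  proof (cases "odd a")
    case True
    then obtain r where r: "a = 2 * r + 1" by (rule oddE)
    then have "r < N" using assms(5) by simp
    then have "(\<Prod>r<N. x + 2 * mu * (2 * real r + 1)) = 0" using r f1 by (intro prod_zero) auto
    then have "(\<Prod>r<N. x + 2 * mu * (2 * real r + 2)) = 0" using z by linarith
    then obtain s where "a = 2 * s + 2" using f2 by (auto simp: prod_zero_iff)
    then show False using True by simp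
  next
    case False
    then obtain i where "a = 2 * i" by auto
    then obtain r where r: "a = 2 * r + 2" using assms(4) by (cases i) auto
    then have "r < N" using assms(5) by simp
    then have "(\<Prod>r<N. x + 2 * mu * (2 * real r + 2)) = 0" using r f2 by (intro prod_zero) auto
    then have "(\<Prod>r<N. x + 2 * mu * (2 * real r + 1)) = 0" using z by linarith
    then obtain s where "a = 2 * s + 1" using f1 by (auto simp: prod_zero_iff)
    then show False using False by simp
  qed
qed

text \<open>Summing the eigenvectors \<open>w\<close> over the roots with weights
  \<open>1 / D\<close> picks out coefficients of degree \<open>N\<close>: 1 for \<open>w 0\<close>,
  and 0 for \<open>w k\<close> with \<open>k >= 1\<close>, whose degree is at most
  \<open>N - k\<close>. The same weights therefore produce both the initial state and the constant
  source \<open>xi\<close> at level 0.\<close>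

lemma level_zero_solution:
  fixes p :: "nat \<Rightarrow> real \<Rightarrow> real"
  assumes mu: "mu > 0" and xi: "xi > 0" and N: "N \<ge> 1" and er: "enumerates_roots N mu \<alpha>"
    and init: "\<And>k. p k 0 = (if k = 0 then 1 else 0)"
    and p0: "\<And>t. t \<ge> 0 \<Longrightarrow> (p 0 has_real_derivative
       mu * (real N + 1) * p 1 t - (mu * real N + xi) * p 0 t + xi) (at t within {0..})"
    and pk: "\<And>k t. k \<ge> 1 \<Longrightarrow> k \<le> N \<Longrightarrow> t \<ge> 0 \<Longrightarrow> (p k has_real_derivative
       mu * (real N - real k + 1) * p (k - 1) t + mu * (real N + real k + 1) * p (k + 1) t
       - (2 * mu * real N + xi) * p k t) (at t within {0..})"
    and above: "\<And>k t. k > N \<Longrightarrow> p k t = 0"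
    and t: "t \<ge> 0"
  shows "p 0 t = 2 * (\<Sum>k=1..N+1. R_coeff N mu \<alpha> k * (1 - theta2 xi t \<bar>\<alpha> k\<bar>))"
proof -
  define w where "w k = smult (mu ^ N * fact N) (krawtchouk_poly mu N (N - k))" for k
  define D where "D i = (\<Prod>s\<in>{1..N+1}-{i}. \<alpha> i - \<alpha> s)" for i
  define f where "f i t = 1 - theta2 xi t \<bar>\<alpha> i\<bar>" for i t
  define h where "h k t = (\<Sum>i=1..N+1. poly (w k) (\<alpha> i) / D i * f i t)" for k t
  let ?a = "\<lambda>m. mu * (real N - real m + 1)" and ?c = "\<lambda>m. mu * (real N + real m + 1)"
  let ?b = "\<lambda>m. if m = 0 then - (mu * real N) else - (2 * mu * real N)"
  have inj: "inj_on \<alpha> {1..N+1}"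
    using er unfolding enumerates_roots_def by (intro linorder_inj_onI) force+
  have abs_root: "\<bar>\<alpha> i\<bar> = - \<alpha> i" if "i \<in> {1..N+1}" for i
    using enumerates_roots_nonpos[OF er that] by simp
  have lead: "(\<Sum>i=1..N+1. poly (w k) (\<alpha> i) / D i) = (if k = 0 then 1 else 0)" if "k \<le> N" for k
  proof -
    have deg: "degree (w k) \<le> N - k"
      unfolding w_def using degree_krawtchouk_poly by (intro degree_smult_le[THEN order_trans])
    have "(\<Sum>i=1..N+1. poly (w k) (\<alpha> i) / D i) = coeff (w k) N"
      unfolding D_def using deg that inj by (intro lagrange_leading_coefficient) auto
    also have "\<dots> = (if k = 0 then 1 else 0)"
    proof (cases "k = 0")
      case True
      then show ?thesis using mu by (simp add: w_def coeff_krawtchouk_poly)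
    next
      case False
      then show ?thesis using deg that by (simp add: coeff_eq_0)
    qed
    finally show ?thesis .
  qed
  have eig: "\<alpha> i * poly (w k) (\<alpha> i) = (if k = 0 then 0 else ?a k * poly (w (k - 1)) (\<alpha> i))
      + ?b k * poly (w k) (\<alpha> i) + (if k = N then 0 else ?c k * poly (w (k + 1)) (\<alpha> i))"
    if i: "i \<in> {1..N+1}" and k: "k \<le> N" for i k
  proof (cases "k = 0")
    case True
    \<comment> \<open>Level 0 is the one row that the three-term recurrence does not give; it holds
      because \<alpha> i is a root of P.\<close>
    have "poly (char_poly_P N mu) (\<alpha> i) = 0" using er i unfolding enumerates_roots_def by blast
    then have "poly (smult (mu ^ N * fact N) ([:mu * real N, 1:] * krawtchouk_poly mu N N
      - smult (mu * (real N + 1)) (krawtchouk_poly mu N (N - 1)))) (\<alpha> i) = 0"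
      unfolding char_poly_P_krawtchouk[OF mu N] by simp
    then show ?thesis using True N by (simp add: w_def algebra_simps)
  next
    case False
    define m where "m = N - k"
    have m: "N - (k - 1) = m + 1" "N - (k + 1) = m - 1" "N - k = m" "m = 0 \<longleftrightarrow> k = N"
      "real m = real N - real k"
      using False k by (auto simp: m_def of_nat_diff)
    define K where "K m = poly (krawtchouk_poly mu N m) (\<alpha> i)" for m
    define C where "C = mu ^ N * (fact N :: real)"
    have rec: "mu * (real m + 1) * K (m + 1) + (if m = 0 then 0 else mu * (2 * real N - real m + 1) * K (m - 1))
      = (\<alpha> i + 2 * mu * real N) * K m"
      unfolding K_def by (rule krawtchouk_poly_recurrence[OF mu])
    have rec': "\<alpha> i * K m = ?a k * K (m + 1) - 2 * mu * real N * K m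
      + (if k = N then 0 else ?c k * K (m - 1))"
      using rec unfolding m(4,5) by (cases "k = N") (simp_all add: algebra_simps)
    have "\<alpha> i * (C * K m) = C * (\<alpha> i * K m)" by simp
    also have "\<dots> = ?a k * (C * K (m + 1)) + - (2 * mu * real N) * (C * K m)
      + (if k = N then 0 else ?c k * (C * K (m - 1)))"
      unfolding rec' by (cases "k = N") (simp_all add: algebra_simps)
    finally show ?thesis
      using False unfolding w_def m(1-3) poly_smult K_def C_def by simp
  qed
  have sum_if: "(\<Sum>i=1..N+1. if b then 0 else c * g i) = (if b then 0 else c * (\<Sum>i=1..N+1. g i))"
    for b and c :: real and g :: "nat \<Rightarrow> real"
    by (cases b) (simp_all only: if_True if_False sum.neutral_const sum_distrib_left)
  have dh: "(h k has_real_derivative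
      (if k = 0 then 0 else ?a k * h (k - 1) t) + (?b k - xi) * h k t
      + (if k = N then 0 else ?c k * h (k + 1) t) + (if k = 0 then xi else 0)) (at t within {0..})"
    if k: "k \<le> N" for k t
  proof -
    have df: "(f i has_real_derivative - (xi - \<alpha> i) * f i t + xi) (at t within {0..})"
      if i: "i \<in> {1..N+1}" for i
    proof -
      have "((\<lambda>t. 1 - theta2 xi t \<bar>\<alpha> i\<bar>) has_real_derivative
          0 - (\<bar>\<alpha> i\<bar> - (xi + \<bar>\<alpha> i\<bar>) * theta2 xi t \<bar>\<alpha> i\<bar>)) (at t within {0..})"
        using xi by (intro DERIV_diff DERIV_const theta2_has_derivative) linarith
      then show ?thesis unfolding f_def[abs_def]
        by (rule back_subst[where P = "\<lambda>D. (_ has_real_derivative D) _"])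
          (simp add: abs_root[OF i] algebra_simps)
    qed
    have "(h k has_real_derivative
       (\<Sum>i=1..N+1. poly (w k) (\<alpha> i) / D i * (- (xi - \<alpha> i) * f i t + xi))) (at t within {0..})"
      unfolding h_def[abs_def] by (intro DERIV_sum DERIV_cmult df)
    also have "(\<Sum>i=1..N+1. poly (w k) (\<alpha> i) / D i * (- (xi - \<alpha> i) * f i t + xi))
      = (\<Sum>i=1..N+1. (if k = 0 then 0 else ?a k * (poly (w (k - 1)) (\<alpha> i) / D i * f i t))
         + (?b k - xi) * (poly (w k) (\<alpha> i) / D i * f i t)
         + (if k = N then 0 else ?c k * (poly (w (k + 1)) (\<alpha> i) / D i * f i t))
         + xi * (poly (w k) (\<alpha> i) / D i))"
    proof (rule sum.cong[OF refl])
      fix i assume i: "i \<in> {1..N+1}"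
      have "poly (w k) (\<alpha> i) / D i * (- (xi - \<alpha> i) * f i t + xi)
        = (\<alpha> i * poly (w k) (\<alpha> i)) / D i * f i t - xi * (poly (w k) (\<alpha> i) / D i * f i t)
          + xi * (poly (w k) (\<alpha> i) / D i)"
        by (simp add: algebra_simps add_divide_distrib)
      also have "\<dots> = (if k = 0 then 0 else ?a k * (poly (w (k - 1)) (\<alpha> i) / D i * f i t))
         + (?b k - xi) * (poly (w k) (\<alpha> i) / D i * f i t)
         + (if k = N then 0 else ?c k * (poly (w (k + 1)) (\<alpha> i) / D i * f i t))
         + xi * (poly (w k) (\<alpha> i) / D i)"
        unfolding eig[OF i k]
        by (cases "k = 0"; cases "k = N") (simp_all add: add_divide_distrib diff_divide_distrib algebra_simps)
      finally show "poly (w k) (\<alpha> i) / D i * (- (xi - \<alpha> i) * f i t + xi) = \<dots>" .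
    qed
    also have "\<dots> = (if k = 0 then 0 else ?a k * h (k - 1) t) + (?b k - xi) * h k t
      + (if k = N then 0 else ?c k * h (k + 1) t) + xi * (if k = 0 then 1 else 0)"
      unfolding sum.distrib sum_if sum_distrib_left[symmetric] lead[OF k] h_def by (rule refl)
    finally show ?thesis by (simp add: if_distrib cong: if_cong)
  qed
  have "p 0 t = h 0 t"
  proof (rule tridiagonal_ode_unique[of N p ?a "\<lambda>k. ?b k - xi" ?c "\<lambda>k t. if k = 0 then xi else 0" h])
    fix k and t :: real assume k: "k \<le> N" and t: "t \<ge> 0"
    show "(h k has_real_derivative
      (if k = 0 then 0 else ?a k * h (k - 1) t) + (?b k - xi) * h k t
      + (if k = N then 0 else ?c k * h (k + 1) t) + (if k = 0 then xi else 0)) (at t within {0..})"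
      by (rule dh[OF k])
    show "(p k has_real_derivative
      (if k = 0 then 0 else ?a k * p (k - 1) t) + (?b k - xi) * p k t
      + (if k = N then 0 else ?c k * p (k + 1) t) + (if k = 0 then xi else 0)) (at t within {0..})"
    proof (cases "k = 0")
      case True
      have "(p 0 has_real_derivative
         mu * (real N + 1) * p 1 t - (mu * real N + xi) * p 0 t + xi) (at t within {0..})"
        by (rule p0[OF t])
      then show ?thesis unfolding True
        by (rule back_subst[where P = "\<lambda>D. (_ has_real_derivative D) _"]) (use N in \<open>simp add: algebra_simps\<close>)
    next
      case False
      have "(p k has_real_derivative
         mu * (real N - real k + 1) * p (k - 1) t + mu * (real N + real k + 1) * p (k + 1) t
         - (2 * mu * real N + xi) * p k t) (at t within {0..})"
        using False k t by (intro pk) auto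
      then show ?thesis
        by (rule back_subst[where P = "\<lambda>D. (_ has_real_derivative D) _"])
          (use False above[of "N + 1" t] in \<open>simp add: algebra_simps\<close>)
    qed
  next
    fix k assume k: "k \<le> N"
    show "p k 0 = h k 0" unfolding h_def f_def using lead[OF k] by (simp add: theta2_def init)
  qed (use t in auto)
  also have "h 0 t = 2 * (\<Sum>k=1..N+1. R_coeff N mu \<alpha> k * (1 - theta2 xi t \<bar>\<alpha> k\<bar>))"
    unfolding h_def sum_distrib_left
  proof (intro sum.cong refl)
    fix i
    have "poly (w 0) (\<alpha> i) = (\<Prod>r<N. \<alpha> i + 2 * mu * (2 * real r + 1))"
      unfolding w_def using prod_odd_krawtchouk[OF mu, of N] poly_prod_odd[of mu N "\<alpha> i"] by simp
    then show "poly (w 0) (\<alpha> i) / D i * f i t = 2 * (R_coeff N mu \<alpha> i * (1 - theta2 xi t \<bar>\<alpha> i\<bar>))"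
      unfolding R_coeff_def D_def f_def by simp
  qed
  finally show ?thesis .
qed

section \<open>The Ehrenfest equations\<close>

text \<open>The forward operator for \<open>2N\<close> balls that change urns independently at rate
  \<open>mu\<close>, with \<open>m\<close> balls in one urn and uniform damping
  \<open>xi\<close>.\<close>

definition ehrenfest_generator :: "nat \<Rightarrow> real \<Rightarrow> real \<Rightarrow> (nat \<Rightarrow> real) \<Rightarrow> nat \<Rightarrow> real" where
  "ehrenfest_generator N mu xi F m =
     (if m = 0 then 0 else mu * (2 * real N - real m + 1) * F (m - 1))
     - (2 * mu * real N + xi) * F m
     + (if m = 2 * N then 0 else mu * (real m + 1) * F (m + 1))"

definition ehrenfest_solution ::
  "nat \<Rightarrow> real \<Rightarrow> real \<Rightarrow> (nat \<Rightarrow> real \<Rightarrow> real) \<Rightarrow> (nat \<Rightarrow> real \<Rightarrow> real) \<Rightarrow> bool" where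
  "ehrenfest_solution N mu xi F s \<longleftrightarrow> (\<forall>m\<le>2*N. \<forall>t\<ge>0.
     (F m has_real_derivative ehrenfest_generator N mu xi (\<lambda>m. F m t) m + s m t) (at t within {0..}))"

lemma ehrenfest_solution_sum:
  assumes "\<And>j. j \<in> J \<Longrightarrow> ehrenfest_solution N mu xi (F j) (s j)"
  shows "ehrenfest_solution N mu xi (\<lambda>m t. \<Sum>j\<in>J. a j * F j m t) (\<lambda>m t. \<Sum>j\<in>J. a j * s j m t)"
  unfolding ehrenfest_solution_def
proof (intro allI impI)
  fix m and t :: real assume m: "m \<le> 2 * N" and t: "t \<ge> 0"
  have "((\<lambda>t. \<Sum>j\<in>J. a j * F j m t) has_real_derivative
      (\<Sum>j\<in>J. a j * (ehrenfest_generator N mu xi (\<lambda>m. F j m t) m + s j m t))) (at t within {0..})"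
    using assms m t unfolding ehrenfest_solution_def by (intro DERIV_sum DERIV_cmult) auto
  also have "(\<Sum>j\<in>J. a j * (ehrenfest_generator N mu xi (\<lambda>m. F j m t) m + s j m t))
    = ehrenfest_generator N mu xi (\<lambda>m. \<Sum>j\<in>J. a j * F j m t) m + (\<Sum>j\<in>J. a j * s j m t)"
    unfolding ehrenfest_generator_def
    by (cases "m = 0"; cases "m = 2 * N")
      (simp_all add: sum.distrib sum_subtractf sum_negf sum_distrib_left distrib_left right_diff_distrib mult_ac)
  finally show "((\<lambda>t. \<Sum>j\<in>J. a j * F j m t) has_real_derivative
    ehrenfest_generator N mu xi (\<lambda>m. \<Sum>j\<in>J. a j * F j m t) m + (\<Sum>j\<in>J. a j * s j m t))
    (at t within {0..})" .
qed

lemma ehrenfest_solution_add: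
  assumes "ehrenfest_solution N mu xi F s" "ehrenfest_solution N mu xi G s'"
  shows "ehrenfest_solution N mu xi (\<lambda>m t. F m t + G m t) (\<lambda>m t. s m t + s' m t)"
  using ehrenfest_solution_sum[of "UNIV :: bool set" N mu xi "\<lambda>j. if j then F else G"
      "\<lambda>j. if j then s else s'" "\<lambda>_. 1"] assms
  by (simp add: UNIV_bool add.commute)

text \<open>On an eigenvector the generator acts as multiplication by
  \<open>- (xi + 2 * mu * a)\<close>, so only a scalar equation with input \<open>e\<close>
  remains.\<close>

lemma ehrenfest_solution_mode:
  assumes a: "a \<le> 2 * N"
    and V: "\<And>t. t \<ge> 0 \<Longrightarrow> (V has_real_derivative e t - (xi + 2 * mu * real a) * V t) (at t within {0..})"
  shows "ehrenfest_solution N mu xi (\<lambda>m t. coeff (krawtchouk_gf (2 * N) a) m * V t)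
    (\<lambda>m t. coeff (krawtchouk_gf (2 * N) a) m * e t)"
  unfolding ehrenfest_solution_def
proof (intro allI impI)
  fix m and t :: real assume m: "m \<le> 2 * N" and t: "t \<ge> 0"
  define b where "b = coeff (krawtchouk_gf (2 * N) a)"
  \<comment> \<open>The coefficient recurrence has no upper cutoff, whereas the generator drops the
    neighbour \<open>m + 1\<close> at \<open>m = 2N\<close>; the degree reconciles them.\<close>
  have top: "b (m + 1) = 0" if "m = 2 * N"
    using that degree_krawtchouk_gf[OF a] by (simp add: b_def coeff_eq_0)
  define P where "P = (if m = 0 then 0 else mu * (2 * real N - real m + 1) * b (m - 1))"
  define S where "S = mu * (real m + 1) * b (m + 1)"
  have rec: "P + S = mu * (2 * real N - 2 * real a) * b m"
  proof -
    have "real (m + 1) * b (m + 1) + (if m = 0 then 0 else (2 * real N - real m + 1) * b (m - 1))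
      = (2 * real N - 2 * real a) * b m"
      using krawtchouk_gf_recurrence[OF a, of m] unfolding b_def by (cases "m = 0") simp_all
    then have "mu * (real (m + 1) * b (m + 1) + (if m = 0 then 0 else (2 * real N - real m + 1) * b (m - 1)))
      = mu * ((2 * real N - 2 * real a) * b m)" by simp
    moreover have "P + S = mu * (real (m + 1) * b (m + 1) + (if m = 0 then 0 else (2 * real N - real m + 1) * b (m - 1)))"
      unfolding P_def S_def by (cases "m = 0") (simp_all add: algebra_simps)
    ultimately show ?thesis by simp
  qed
  have "ehrenfest_generator N mu xi (\<lambda>m. b m * V t) m = (P + S) * V t - (2 * mu * real N + xi) * (b m * V t)"
    unfolding ehrenfest_generator_def P_def S_def using top
    by (cases "m = 0"; cases "m = 2 * N") (simp_all add: algebra_simps)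
  also have "\<dots> = b m * (- (xi + 2 * mu * real a) * V t)"
    unfolding rec by (simp add: algebra_simps)
  finally have gen: "ehrenfest_generator N mu xi (\<lambda>m. b m * V t) m = b m * (- (xi + 2 * mu * real a) * V t)" .
  have "((\<lambda>t. b m * V t) has_real_derivative b m * (e t - (xi + 2 * mu * real a) * V t)) (at t within {0..})"
    by (intro DERIV_cmult V t)
  then have "((\<lambda>t. b m * V t) has_real_derivative
    ehrenfest_generator N mu xi (\<lambda>m. b m * V t) m + b m * e t) (at t within {0..})"
    unfolding gen by (rule back_subst[where P = "\<lambda>D. (_ has_real_derivative D) _"])
      (simp add: algebra_simps)
  then show "((\<lambda>t. coeff (krawtchouk_gf (2 * N) a) m * V t) has_real_derivative
    ehrenfest_generator N mu xi (\<lambda>m. coeff (krawtchouk_gf (2 * N) a) m * V t) m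
      + coeff (krawtchouk_gf (2 * N) a) m * e t) (at t within {0..})"
    by (simp only: b_def)
qed

lemma ehrenfest_solution_unique:
  assumes "ehrenfest_solution N mu xi F s" "ehrenfest_solution N mu xi G s"
    and "\<And>m. m \<le> 2 * N \<Longrightarrow> F m 0 = G m 0" "m \<le> 2 * N" "t \<ge> 0"
  shows "F m t = G m t"
proof (rule tridiagonal_ode_unique[of "2 * N" F "\<lambda>m. mu * (2 * real N - real m + 1)"
      "\<lambda>_. - (2 * mu * real N + xi)" "\<lambda>m. mu * (real m + 1)" s G])
  fix m and t :: real assume mt: "m \<le> 2 * N" "t \<ge> 0"
  show "(F m has_real_derivative
      (if m = 0 then 0 else mu * (2 * real N - real m + 1) * F (m - 1) t) + - (2 * mu * real N + xi) * F m t
      + (if m = 2 * N then 0 else mu * (real m + 1) * F (m + 1) t) + s m t) (at t within {0..})"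
    using assms(1)[unfolded ehrenfest_solution_def, rule_format, OF mt]
    by (rule back_subst[where P = "\<lambda>D. (_ has_real_derivative D) _"])
      (simp add: ehrenfest_generator_def algebra_simps)
  show "(G m has_real_derivative
      (if m = 0 then 0 else mu * (2 * real N - real m + 1) * G (m - 1) t) + - (2 * mu * real N + xi) * G m t
      + (if m = 2 * N then 0 else mu * (real m + 1) * G (m + 1) t) + s m t) (at t within {0..})"
    using assms(2)[unfolded ehrenfest_solution_def, rule_format, OF mt]
    by (rule back_subst[where P = "\<lambda>D. (_ has_real_derivative D) _"])
      (simp add: ehrenfest_generator_def algebra_simps)
qed (use assms in auto)

text \<open>Reading the levels downwards from \<open>N\<close>, the level probabilities solve the Ehrenfest equations
  on \<open>{0..2 * N}\<close>, with a source that keeps the positions above \<open>N\<close> empty.\<close>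

lemma level_probabilities_ehrenfest:
  fixes p :: "nat \<Rightarrow> real \<Rightarrow> real"
  assumes N: "N \<ge> 1"
    and p0: "\<And>t. t \<ge> 0 \<Longrightarrow> (p 0 has_real_derivative
       mu * (real N + 1) * p 1 t - (mu * real N + xi) * p 0 t + xi) (at t within {0..})"
    and pk: "\<And>k t. k \<ge> 1 \<Longrightarrow> k \<le> N \<Longrightarrow> t \<ge> 0 \<Longrightarrow> (p k has_real_derivative
       mu * (real N - real k + 1) * p (k - 1) t + mu * (real N + real k + 1) * p (k + 1) t
       - (2 * mu * real N + xi) * p k t) (at t within {0..})"
    and above: "\<And>k t. k > N \<Longrightarrow> p k t = 0"
  shows "ehrenfest_solution N mu xi (\<lambda>m t. if m \<le> N then p (N - m) t else 0)
    (\<lambda>m t. (if m = N then xi else 0)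
       + mu * real N * p 0 t * ((if m = N then 1 else 0) - (if m = N + 1 then 1 else 0)))"
  unfolding ehrenfest_solution_def
proof (intro allI impI)
  fix m and t :: real assume m: "m \<le> 2 * N" and t: "t \<ge> 0"
  let ?F = "\<lambda>m t. if m \<le> N then p (N - m) t else 0"
  let ?s = "(if m = N then xi else 0)
       + mu * real N * p 0 t * ((if m = N then 1 else 0) - (if m = N + 1 then 1 else 0))"
  consider "m < N" | "m = N" | "m = N + 1" | "m > N + 1" by linarith
  then show "(?F m has_real_derivative ehrenfest_generator N mu xi (\<lambda>m. ?F m t) m + ?s) (at t within {0..})"
  proof cases
    case 1
    define k where "k = N - m"
    have k: "k \<ge> 1" "k \<le> N" "N - (m + 1) = k - 1" "m + 1 \<le> N" "real m = real N - real k"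
      using 1 by (auto simp: k_def of_nat_diff)
    have prev: "(if m = 0 then 0 else mu * (2 * real N - real m + 1) * ?F (m - 1) t)
       = mu * (real N + real k + 1) * p (k + 1) t"
    proof (cases "m = 0")
      case True
      then show ?thesis using above[of "k + 1" t] by (simp add: k_def)
    next
      case False
      then have "N - (m - 1) = k + 1" "m - 1 \<le> N" using 1 by (auto simp: k_def)
      moreover have "2 * real N - real m + 1 = real N + real k + 1" using k(5) by simp
      ultimately show ?thesis using False by simp
    qed
    have "m \<noteq> 2 * N" using 1 by simp
    then have "ehrenfest_generator N mu xi (\<lambda>m. ?F m t) m + ?s
      = mu * (real N - real k + 1) * p (k - 1) t + mu * (real N + real k + 1) * p (k + 1) t
       - (2 * mu * real N + xi) * p k t"
      unfolding ehrenfest_generator_def prev using 1 k(3-5) by (simp add: k_def)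
    moreover have "?F m = p k" using 1 by (auto simp: k_def)
    ultimately show ?thesis using pk[OF k(1,2) t] by simp
  next
    case 2
    have "N - (N - 1) = 1" "N \<noteq> 0" "N \<noteq> 2 * N" using N by auto
    \<comment> \<open>The generator charges an outflow \<open>2 * mu * N\<close> where level 0 loses
      only \<open>mu * N\<close>; the positive part of the source pays the difference back.\<close>
    then have "ehrenfest_generator N mu xi (\<lambda>m. ?F m t) m + ?s
      = mu * (real N + 1) * p 1 t - (mu * real N + xi) * p 0 t + xi"
      unfolding ehrenfest_generator_def 2 by (simp add: algebra_simps)
    moreover have "?F m = p 0" using 2 by auto
    ultimately show ?thesis using p0[OF t] by simp
  next
    case 3
    \<comment> \<open>From position \<open>N\<close> the generator pushes
      \<open>mu * N * p 0 t\<close> up to \<open>N + 1\<close>; the negative part of the source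
      removes exactly that.\<close>
    have "ehrenfest_generator N mu xi (\<lambda>m. ?F m t) m + ?s = 0"
      unfolding ehrenfest_generator_def 3 by (simp add: algebra_simps)
    moreover have "?F m = (\<lambda>_. 0)" using 3 by auto
    ultimately show ?thesis by (metis DERIV_const)
  next
    case 4
    have "ehrenfest_generator N mu xi (\<lambda>m. ?F m t) m + ?s = 0"
      unfolding ehrenfest_generator_def using 4 by auto
    moreover have "?F m = (\<lambda>_. 0)" using 4 by auto
    ultimately show ?thesis by (metis DERIV_const)
  qed
qed

text \<open>For a single root, the difference of the two \<open>theta2\<close> terms over the gap of
  their decay rates solves the scalar equation with decay \<open>xi + y\<close> and input minus
  \<open>1 - theta2\<close> at the root. The weighted sum is thus the response of one Ehrenfest mode
  to \<open>- p(0,t) / 2\<close>, starting from 0.\<close>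

lemma root_response_has_derivative:
  fixes mu xi :: real
  assumes mu: "mu > 0" and xi: "xi > 0" and er: "enumerates_roots N mu \<alpha>"
    and a: "1 \<le> a" "a \<le> 2 * N"
  defines "y \<equiv> 2 * mu * real a"
  shows "((\<lambda>t. \<Sum>k=1..N+1. R_coeff N mu \<alpha> k / (\<bar>\<alpha> k\<bar> - y) * (theta2 xi t y - theta2 xi t \<bar>\<alpha> k\<bar>))
    has_real_derivative - (\<Sum>k=1..N+1. R_coeff N mu \<alpha> k * (1 - theta2 xi t \<bar>\<alpha> k\<bar>))
      - (xi + y) * (\<Sum>k=1..N+1. R_coeff N mu \<alpha> k / (\<bar>\<alpha> k\<bar> - y) * (theta2 xi t y - theta2 xi t \<bar>\<alpha> k\<bar>)))
    (at t within A)"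
proof -
  have y: "xi + y \<noteq> 0" using mu xi unfolding y_def by (smt (verit) mult_nonneg_nonneg of_nat_0_le_iff)
  have "((\<lambda>t. \<Sum>k=1..N+1. R_coeff N mu \<alpha> k / (\<bar>\<alpha> k\<bar> - y) * (theta2 xi t y - theta2 xi t \<bar>\<alpha> k\<bar>))
    has_real_derivative (\<Sum>k=1..N+1. R_coeff N mu \<alpha> k / (\<bar>\<alpha> k\<bar> - y) *
      ((y - (xi + y) * theta2 xi t y) - (\<bar>\<alpha> k\<bar> - (xi + \<bar>\<alpha> k\<bar>) * theta2 xi t \<bar>\<alpha> k\<bar>)))) (at t within A)"
    using xi by (intro DERIV_sum DERIV_cmult DERIV_diff theta2_has_derivative y) linarith
  also have "(\<Sum>k=1..N+1. R_coeff N mu \<alpha> k / (\<bar>\<alpha> k\<bar> - y) *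
      ((y - (xi + y) * theta2 xi t y) - (\<bar>\<alpha> k\<bar> - (xi + \<bar>\<alpha> k\<bar>) * theta2 xi t \<bar>\<alpha> k\<bar>)))
    = (\<Sum>k=1..N+1. - (R_coeff N mu \<alpha> k * (1 - theta2 xi t \<bar>\<alpha> k\<bar>))
      - (xi + y) * (R_coeff N mu \<alpha> k / (\<bar>\<alpha> k\<bar> - y) * (theta2 xi t y - theta2 xi t \<bar>\<alpha> k\<bar>)))"
  proof (rule sum.cong[OF refl])
    fix k assume k: "k \<in> {1..N+1}"
    define R where "R = R_coeff N mu \<alpha> k"
    define b where "b = \<bar>\<alpha> k\<bar>"
    have ne: "b - y \<noteq> 0" using enumerates_roots_avoid[OF mu er k a] by (simp add: b_def y_def)
    have "(y - (xi + y) * theta2 xi t y) - (b - (xi + b) * theta2 xi t b)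
      = - ((b - y) * (1 - theta2 xi t b)) - (xi + y) * (theta2 xi t y - theta2 xi t b)"
      by (simp add: algebra_simps)
    then have "c * ((y - (xi + y) * theta2 xi t y) - (b - (xi + b) * theta2 xi t b))
      = - (c * (b - y) * (1 - theta2 xi t b)) - (xi + y) * (c * (theta2 xi t y - theta2 xi t b))" for c
      by (simp add: algebra_simps)
    note this [of "R / (b - y)"]
    also have "R / (b - y) * (b - y) = R" using ne by simp
    finally show "R_coeff N mu \<alpha> k / (\<bar>\<alpha> k\<bar> - y) *
      ((y - (xi + y) * theta2 xi t y) - (\<bar>\<alpha> k\<bar> - (xi + \<bar>\<alpha> k\<bar>) * theta2 xi t \<bar>\<alpha> k\<bar>))
      = - (R_coeff N mu \<alpha> k * (1 - theta2 xi t \<bar>\<alpha> k\<bar>))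
      - (xi + y) * (R_coeff N mu \<alpha> k / (\<bar>\<alpha> k\<bar> - y) * (theta2 xi t y - theta2 xi t \<bar>\<alpha> k\<bar>))"
      by (simp only: R_def b_def)
  qed
  also have "\<dots> = - (\<Sum>k=1..N+1. R_coeff N mu \<alpha> k * (1 - theta2 xi t \<bar>\<alpha> k\<bar>))
      - (xi + y) * (\<Sum>k=1..N+1. R_coeff N mu \<alpha> k / (\<bar>\<alpha> k\<bar> - y) * (theta2 xi t y - theta2 xi t \<bar>\<alpha> k\<bar>))"
    by (simp only: sum_subtractf sum_negf sum_distrib_left)
  finally show ?thesis .
qed

section \<open>The remaining levels\<close>

text \<open>The first sum carries the initial state and the constant source; the other two start at
  0 and answer the source containing p(0,t). Their signs are opposite to those in
  \<open>monom_diff_krawtchouk_expansion\<close> because \<open>U\<close> responds to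
  \<open>- q\<close>.\<close>

lemma level_solution:
  fixes p :: "nat \<Rightarrow> real \<Rightarrow> real"
  assumes mu: "mu > 0" and xi: "xi > 0" and N: "N \<ge> 1" and er: "enumerates_roots N mu \<alpha>"
    and init: "\<And>k. p k 0 = (if k = 0 then 1 else 0)"
    and p0: "\<And>t. t \<ge> 0 \<Longrightarrow> (p 0 has_real_derivative
       mu * (real N + 1) * p 1 t - (mu * real N + xi) * p 0 t + xi) (at t within {0..})"
    and pk: "\<And>k t. k \<ge> 1 \<Longrightarrow> k \<le> N \<Longrightarrow> t \<ge> 0 \<Longrightarrow> (p k has_real_derivative
       mu * (real N - real k + 1) * p (k - 1) t + mu * (real N + real k + 1) * p (k + 1) t
       - (2 * mu * real N + xi) * p k t) (at t within {0..})"
    and above: "\<And>k t. k > N \<Longrightarrow> p k t = 0"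
    and m: "m \<le> N" and t: "t \<ge> 0"
  defines "U \<equiv> \<lambda>y t. \<Sum>k=1..N+1. R_coeff N mu \<alpha> k / (\<bar>\<alpha> k\<bar> - y) * (theta2 xi t y - theta2 xi t \<bar>\<alpha> k\<bar>)"
  shows "p (N - m) t =
      (\<Sum>l\<le>N. (1 / 4 ^ N * (real (N choose l) * (-1) ^ l)) *
         (coeff (krawtchouk_gf (2 * N) (2 * l)) m * (1 - theta2 xi t (2 * mu * real (2 * l)))))
      + ((\<Sum>j\<le>N-1. (mu * real N / 2 ^ (2*N-2) * (real ((N-1) choose j) * (-1) ^ (N-1-j))) *
           (coeff (krawtchouk_gf (2 * N) (2 * N - 2 * j)) m * U (2 * mu * real (2 * N - 2 * j)) t))
       + (\<Sum>j\<le>N-1. (- (mu * real N / 2 ^ (2*N-2) * (real ((N-1) choose j) * (-1) ^ (N-1-j)))) *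
           (coeff (krawtchouk_gf (2 * N) (2 * N - 2 * j - 1)) m * U (2 * mu * real (2 * N - 2 * j - 1)) t)))"
proof -
  define b where "b a m = coeff (krawtchouk_gf (2 * N) a) m" for a m
  define cA where "cA l = 1 / 4 ^ N * (real (N choose l) * (-1) ^ l)" for l
  define cB where "cB j = mu * real N / 2 ^ (2*N-2) * (real ((N-1) choose j) * (-1) ^ (N-1-j))" for j
  \<comment> \<open>Half of \<open>p 0\<close> is the sum over the roots with weights
    \<open>R_coeff\<close>; the missing factor 2 reappears in \<open>eB\<close>.\<close>
  define q where "q t = p 0 t / 2" for t
  let ?y = "\<lambda>a. 2 * mu * real a"
  have q: "q t = (\<Sum>k=1..N+1. R_coeff N mu \<alpha> k * (1 - theta2 xi t \<bar>\<alpha> k\<bar>))" if "t \<ge> 0" for t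
    using level_zero_solution[OF mu xi N er init p0 pk above that] by (simp add: q_def)
  have A: "ehrenfest_solution N mu xi (\<lambda>m t. b a m * (1 - theta2 xi t (?y a))) (\<lambda>m t. b a m * xi)"
    if "a \<le> 2 * N" for a
    unfolding b_def
  proof (rule ehrenfest_solution_mode[OF that])
    fix t :: real
    have "xi + ?y a \<noteq> 0"
      using mu xi by (smt (verit) mult_nonneg_nonneg of_nat_0_le_iff)
    then have "((\<lambda>t. 1 - theta2 xi t (?y a)) has_real_derivative
        0 - (?y a - (xi + ?y a) * theta2 xi t (?y a))) (at t within {0..})"
      by (intro DERIV_diff DERIV_const theta2_has_derivative)
    then show "((\<lambda>t. 1 - theta2 xi t (?y a)) has_real_derivative
        xi - (xi + ?y a) * (1 - theta2 xi t (?y a))) (at t within {0..})"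
      by (rule back_subst[where P = "\<lambda>D. (_ has_real_derivative D) _"]) (simp add: algebra_simps)
  qed
  have B: "ehrenfest_solution N mu xi (\<lambda>m t. b a m * U (?y a) t) (\<lambda>m t. b a m * - q t)"
    if a: "1 \<le> a" "a \<le> 2 * N" for a
    unfolding b_def
  proof (rule ehrenfest_solution_mode[OF a(2)])
    fix t :: real assume t: "t \<ge> 0"
    show "(U (?y a) has_real_derivative - q t - (xi + ?y a) * U (?y a) t) (at t within {0..})"
      unfolding U_def q[OF t] by (rule root_response_has_derivative[OF mu xi er a])
  qed
  let ?G = "\<lambda>m t. (\<Sum>l\<le>N. cA l * (b (2 * l) m * (1 - theta2 xi t (?y (2 * l)))))
     + ((\<Sum>j\<le>N-1. cB j * (b (2 * N - 2 * j) m * U (?y (2 * N - 2 * j)) t))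
      + (\<Sum>j\<le>N-1. - cB j * (b (2 * N - 2 * j - 1) m * U (?y (2 * N - 2 * j - 1)) t)))"
  let ?s = "\<lambda>m t. (\<Sum>l\<le>N. cA l * (b (2 * l) m * xi))
     + ((\<Sum>j\<le>N-1. cB j * (b (2 * N - 2 * j) m * - q t))
      + (\<Sum>j\<le>N-1. - cB j * (b (2 * N - 2 * j - 1) m * - q t)))"
  have G: "ehrenfest_solution N mu xi ?G ?s"
    by (intro ehrenfest_solution_add ehrenfest_solution_sum A B) (use N in auto)
  have eA: "(\<Sum>l\<le>N. cA l * b (2 * l) m) = (if m = N then 1 else 0)" for m
  proof -
    have "(\<Sum>l\<le>N. cA l * b (2 * l) m)
      = 1 / 4 ^ N * coeff (\<Sum>l\<le>N. smult (real (N choose l) * (-1) ^ l) (krawtchouk_gf (2 * N) (2 * l))) m"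
      unfolding coeff_sum coeff_smult cA_def b_def sum_distrib_left by (intro sum.cong refl) (simp only: mult.assoc)
    then show ?thesis unfolding monom_krawtchouk_expansion by simp
  qed
  have eB: "(\<Sum>j\<le>N-1. cB j * (b (2 * N - 2 * j - 1) m - b (2 * N - 2 * j) m))
    = 2 * mu * real N * ((if m = N then 1 else 0) - (if m = N + 1 then 1 else 0))" for m
  proof -
    have "2 * N - 2 = 2 * (N - 1)" by simp
    then have pw: "(2::real) ^ (2 * N - 2) = 4 ^ (N - 1)" by (simp only: power_mult) simp
    have "(\<Sum>j\<le>N-1. cB j * (b (2 * N - 2 * j - 1) m - b (2 * N - 2 * j) m))
      = mu * real N / 2 ^ (2 * N - 2) * coeff (\<Sum>j\<le>N-1. smult (real ((N - 1) choose j) * (-1) ^ (N - 1 - j))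
      (krawtchouk_gf (2 * N) (2 * N - 2 * j - 1) - krawtchouk_gf (2 * N) (2 * N - 2 * j))) m"
      unfolding coeff_sum coeff_smult coeff_diff cB_def b_def sum_distrib_left
      by (intro sum.cong refl) (simp only: mult.assoc)
    also have "\<dots> = mu * real N / 2 ^ (2 * N - 2)
      * (2 * 4 ^ (N - 1) * ((if m = N then 1 else 0) - (if m = N + 1 then 1 else 0)))"
      unfolding monom_diff_krawtchouk_expansion[OF N] by auto
    finally show ?thesis unfolding pw by simp
  qed
  have s: "?s = (\<lambda>m t. (if m = N then xi else 0)
       + mu * real N * p 0 t * ((if m = N then 1 else 0) - (if m = N + 1 then 1 else 0)))"
  proof (intro ext)
    fix m t
    have "(\<Sum>l\<le>N. cA l * (b (2 * l) m * xi)) = (if m = N then xi else 0)"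
      unfolding mult.assoc[symmetric] sum_distrib_right[symmetric] eA by simp
    moreover have "(\<Sum>j\<le>N-1. cB j * (b (2 * N - 2 * j) m * - q t)) + (\<Sum>j\<le>N-1. - cB j * (b (2 * N - 2 * j - 1) m * - q t))
      = (\<Sum>j\<le>N-1. cB j * (b (2 * N - 2 * j - 1) m - b (2 * N - 2 * j) m)) * q t"
      unfolding sum.distrib[symmetric] sum_distrib_right
      by (intro sum.cong refl) (simp add: algebra_simps)
    ultimately show "?s m t = (if m = N then xi else 0)
       + mu * real N * p 0 t * ((if m = N then 1 else 0) - (if m = N + 1 then 1 else 0))"
      unfolding eB by (simp add: q_def)
  qed
  have m2: "m \<le> 2 * N" using m by simp
  have "(if m \<le> N then p (N - m) t else 0) = ?G m t"
  proof (rule ehrenfest_solution_unique[OF level_probabilities_ehrenfest[OF N p0 pk above, folded s] G _ m2 t])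
    fix m assume "m \<le> 2 * N"
    have "U y 0 = 0" for y by (simp add: U_def theta2_def)
    moreover have "theta2 xi 0 y = 0" for y by (simp add: theta2_def)
    ultimately have "?G m 0 = (if m = N then 1 else 0)" by (simp add: eA)
    then show "(if m \<le> N then p (N - m) 0 else 0) = ?G m 0" using init by auto
  qed
  then show ?thesis using m by (simp only: cA_def cB_def b_def if_True)
qed

lemma krawtchouk_even_theta1:
  assumes "r \<le> N" "j \<le> N"
  shows "coeff (krawtchouk_gf (2 * N) (2 * N - 2 * j)) (N - r)
    = (-1) ^ (N - r) * (real ((2*N) choose (N+r)) * theta1 N r (2 * j) 0 0)"
  using assms theta1_krawtchouk_00[of r N "2 * j"] krawtchouk_gf_complement[of "2 * j" "2 * N" "N - r"]
  by simp

text \<open>The index is the complement of \<open>2j + 1\<close>. Removing one factor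
  \<open>1 - z\<close> leaves a difference of neighbouring coefficients over \<open>2N - 1\<close>,
  hence the pair of \<open>theta1\<close> terms. The minus sign on the left is the one these modes
  carry in \<open>level_solution\<close>.\<close>

lemma krawtchouk_odd_theta1:
  assumes "1 \<le> r" "r \<le> N" "j \<le> N - 1"
  shows "- coeff (krawtchouk_gf (2 * N) (2 * N - 2 * j - 1)) (N - r)
    = (-1) ^ (N - r) * (real ((2*N-1) choose (N+r)) * theta1 N r (2 * j) 1 1
        - real ((2*N-1) choose (N+r-1)) * theta1 N r (2 * j) 0 1)"
proof -
  have e: "2 * N - 2 * j - 1 = 2 * N - (2 * j + 1)" by simp
  have S: "2 * N = Suc (2 * N - 1)" "2 * j + 1 = Suc (2 * j)" using assms by auto
  have le: "2 * j \<le> 2 * N - 1" using assms by simp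
  have "coeff (krawtchouk_gf (2 * N) (2 * N - 2 * j - 1)) (N - r)
    = (-1) ^ (N - r) * coeff (krawtchouk_gf (2 * N) (2 * j + 1)) (N - r)"
    unfolding e using assms by (intro krawtchouk_gf_complement) simp
  also have "coeff (krawtchouk_gf (2 * N) (2 * j + 1)) (N - r)
    = coeff (krawtchouk_gf (2 * N - 1) (2 * j)) (N - r)
     - (if N - r = 0 then 0 else coeff (krawtchouk_gf (2 * N - 1) (2 * j)) (N - r - 1))"
    using krawtchouk_gf_Suc[of "2 * N - 1" "2 * j" "N - r"] unfolding S[symmetric] .
  also have "\<dots> = real ((2*N-1) choose (N+r-1)) * theta1 N r (2 * j) 0 1
      - real ((2*N-1) choose (N+r)) * theta1 N r (2 * j) 1 1"
    unfolding theta1_krawtchouk_01[OF assms(1,2) le] theta1_krawtchouk_11[OF assms(1,2) le]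
    using assms(2) by auto
  finally show ?thesis by (simp add: algebra_simps)
qed

theorem proposition3p3:
  fixes N d l0 :: nat and lam mu xi :: real
    and c :: "nat \<Rightarrow> nat \<Rightarrow> real"
    and M :: "'a measure" and X :: "real \<Rightarrow> 'a \<Rightarrow> nat \<times> nat"
    and \<alpha> :: "nat \<Rightarrow> real"
  assumes "N \<ge> 1" and "d \<ge> 1"
    and "lam > 0" and "mu > 0" and "xi > 0"
    and "stochastic_matrix_on {1..d} c" and "irreducible_matrix_on {1..d} c"
    and "l0 \<in> {1..d}"
    and "markov_chain_with_rates M (states N d) (rates N c lam mu xi) X"
    and "AE \<omega> in M. X 0 \<omega> = (0, l0)"
    and "enumerates_roots N mu \<alpha>"
    and "lam = mu"
  shows "\<forall>t>0.
    p_level M X d l0 0 t =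
      2 * real ((2*N) choose N) / (real ((2*N) choose N) + 4 ^ N)
      + 2 * (\<Sum>k=2..N+1. R_coeff N mu \<alpha> k *
          (exp (- (xi - \<alpha> k) * t) + xi / (xi - \<alpha> k) * (1 - exp (- (xi - \<alpha> k) * t))))
    \<and>
    (\<forall>r\<in>{1..N}.
      p_level M X d l0 r t =
        1 / 4 ^ N * real ((2*N) choose (N+r)) *
          (\<Sum>l=0..N. real (N choose l) * (-1) ^ l * theta1 N r (2*l) 0 0 *
             (1 - theta2 xi t (4 * real l * mu)))
        + mu * real N / 2 ^ (2*N-2) * (-1) ^ (N-r) *
          (\<Sum>j=0..N-1. real ((N-1) choose j) * (-1) ^ (N-1-j) *
             (real ((2*N-1) choose (N+r)) * theta1 N r (2*j) 1 1
              - real ((2*N-1) choose (N+r-1)) * theta1 N r (2*j) 0 1) *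
             (\<Sum>k=1..N+1. R_coeff N mu \<alpha> k /
                (\<bar>\<alpha> k\<bar> - 2 * mu * (2 * real N - 2 * real j - 1)) *
                (theta2 xi t (2 * mu * (2 * real N - 2 * real j - 1)) - theta2 xi t \<bar>\<alpha> k\<bar>)))
        + mu * real N / 2 ^ (2*N-2) * (-1) ^ (N-r) * real ((2*N) choose (N+r)) *
          (\<Sum>j=0..N-1. real ((N-1) choose j) * (-1) ^ (N-1-j) * theta1 N r (2*j) 0 0 *
             (\<Sum>k=1..N+1. R_coeff N mu \<alpha> k /
                (\<bar>\<alpha> k\<bar> - 4 * mu * (real N - real j)) *
                (theta2 xi t (4 * mu * (real N - real j)) - theta2 xi t \<bar>\<alpha> k\<bar>))))"
proof (rule p_level_forward_equations[OF assms(1,6,8) assms(9)[unfolded assms(12)] assms(10)])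
  note N = assms(1) and mu = assms(4) and xi = assms(5) and er = assms(11)
  fix p
  assume lev: "\<And>k t. k \<le> N \<Longrightarrow> t > 0 \<Longrightarrow> p_level M X d l0 k t = p k t"
    and init: "\<And>k. p k 0 = (if k = 0 then 1 else 0)"
    and p0: "\<And>t. t \<ge> 0 \<Longrightarrow> (p 0 has_real_derivative
       mu * (real N + 1) * p 1 t - (mu * real N + xi) * p 0 t + xi) (at t within {0..})"
    and pk: "\<And>k t. k \<ge> 1 \<Longrightarrow> k \<le> N \<Longrightarrow> t \<ge> 0 \<Longrightarrow> (p k has_real_derivative
       mu * (real N - real k + 1) * p (k - 1) t + mu * (real N + real k + 1) * p (k + 1) t
       - (2 * mu * real N + xi) * p k t) (at t within {0..})"
    and above: "\<And>k t. k > N \<Longrightarrow> p k t = 0"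
  show ?thesis
  proof (intro allI impI)
    fix t :: real assume t: "t > 0"
    define U where "U y = (\<Sum>k=1..N+1. R_coeff N mu \<alpha> k / (\<bar>\<alpha> k\<bar> - y) * (theta2 xi t y - theta2 xi t \<bar>\<alpha> k\<bar>))"
      for y
    let ?p0 = "2 * real ((2*N) choose N) / (real ((2*N) choose N) + 4 ^ N)
        + 2 * (\<Sum>k=2..N+1. R_coeff N mu \<alpha> k *
            (exp (- (xi - \<alpha> k) * t) + xi / (xi - \<alpha> k) * (1 - exp (- (xi - \<alpha> k) * t))))"
    have "p 0 t = 2 * (\<Sum>k=1..N+1. R_coeff N mu \<alpha> k * (1 - theta2 xi t \<bar>\<alpha> k\<bar>))"
      using level_zero_solution[OF mu xi N er init p0 pk above] t by simp
    \<comment> \<open>The root \<alpha> 1 = 0 gives the part constant in time, since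
      \<open>theta2\<close> vanishes at \<open>y = 0\<close>; it becomes the leading
      fraction.\<close>
    also have "{1..N+1} = insert 1 {2..N+1}" by auto
    also have "(\<Sum>k\<in>insert 1 {2..N+1}. R_coeff N mu \<alpha> k * (1 - theta2 xi t \<bar>\<alpha> k\<bar>))
      = R_coeff N mu \<alpha> 1 * (1 - theta2 xi t \<bar>\<alpha> 1\<bar>)
        + (\<Sum>k=2..N+1. R_coeff N mu \<alpha> k * (1 - theta2 xi t \<bar>\<alpha> k\<bar>))"
      by (rule sum.insert) auto
    also have "theta2 xi t \<bar>\<alpha> 1\<bar> = 0"
      using er xi unfolding enumerates_roots_def by (simp add: theta2_def)
    also have "(\<Sum>k=2..N+1. R_coeff N mu \<alpha> k * (1 - theta2 xi t \<bar>\<alpha> k\<bar>))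
      = (\<Sum>k=2..N+1. R_coeff N mu \<alpha> k *
            (exp (- (xi - \<alpha> k) * t) + xi / (xi - \<alpha> k) * (1 - exp (- (xi - \<alpha> k) * t))))"
    proof (intro sum.cong refl arg_cong2[where f = "(*)"])
      fix k assume "k \<in> {2..N+1}"
      then have "\<bar>\<alpha> k\<bar> = - \<alpha> k" using enumerates_roots_nonpos[OF er, of k] by simp
      moreover have "- t * (xi - \<alpha> k) = - (xi - \<alpha> k) * t" by (simp add: algebra_simps)
      \<comment> \<open>With \<open>e\<close> the exponential and
        \<open>c = xi / (xi - \<alpha> k)\<close>, this is
        \<open>1 - (1 - e)(1 - c) = e + c (1 - e)\<close>.\<close>
      ultimately show "1 - theta2 xi t \<bar>\<alpha> k\<bar> = exp (- (xi - \<alpha> k) * t) + xi / (xi - \<alpha> k) * (1 - exp (- (xi - \<alpha> k) * t))"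
        unfolding theta2_def by (simp only: add_uminus_conv_diff) (simp add: algebra_simps)
    qed
    finally have zero: "p_level M X d l0 0 t = ?p0"
      unfolding R_coeff_first[OF mu er] lev[OF le0 t] by (simp add: distrib_left)
    show "p_level M X d l0 0 t = ?p0 \<and> (\<forall>r\<in>{1..N}.
        p_level M X d l0 r t =
          1 / 4 ^ N * real ((2*N) choose (N+r)) *
            (\<Sum>l=0..N. real (N choose l) * (-1) ^ l * theta1 N r (2*l) 0 0 *
               (1 - theta2 xi t (4 * real l * mu)))
          + mu * real N / 2 ^ (2*N-2) * (-1) ^ (N-r) *
            (\<Sum>j=0..N-1. real ((N-1) choose j) * (-1) ^ (N-1-j) *
               (real ((2*N-1) choose (N+r)) * theta1 N r (2*j) 1 1
                - real ((2*N-1) choose (N+r-1)) * theta1 N r (2*j) 0 1) *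
               (\<Sum>k=1..N+1. R_coeff N mu \<alpha> k /
                  (\<bar>\<alpha> k\<bar> - 2 * mu * (2 * real N - 2 * real j - 1)) *
                  (theta2 xi t (2 * mu * (2 * real N - 2 * real j - 1)) - theta2 xi t \<bar>\<alpha> k\<bar>)))
          + mu * real N / 2 ^ (2*N-2) * (-1) ^ (N-r) * real ((2*N) choose (N+r)) *
            (\<Sum>j=0..N-1. real ((N-1) choose j) * (-1) ^ (N-1-j) * theta1 N r (2*j) 0 0 *
               (\<Sum>k=1..N+1. R_coeff N mu \<alpha> k /
                  (\<bar>\<alpha> k\<bar> - 4 * mu * (real N - real j)) *
                  (theta2 xi t (4 * mu * (real N - real j)) - theta2 xi t \<bar>\<alpha> k\<bar>))))"
      unfolding U_def[symmetric]
    proof (intro conjI ballI)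
      fix r assume r: "r \<in> {1..N}"
      let ?C = "real ((2*N) choose (N+r))" and ?K = "mu * real N / 2 ^ (2*N-2)"
      let ?D = "\<lambda>j. real ((2*N-1) choose (N+r)) * theta1 N r (2*j) 1 1
                - real ((2*N-1) choose (N+r-1)) * theta1 N r (2*j) 0 1"
      have "p_level M X d l0 r t = p (N - (N - r)) t" using r lev[of r t] t by simp
      also have "\<dots> = (\<Sum>l\<le>N. (1 / 4 ^ N * (real (N choose l) * (-1) ^ l)) *
           (coeff (krawtchouk_gf (2 * N) (2 * l)) (N - r) * (1 - theta2 xi t (2 * mu * real (2 * l)))))
        + ((\<Sum>j\<le>N-1. (?K * (real ((N-1) choose j) * (-1) ^ (N-1-j))) *
             (coeff (krawtchouk_gf (2 * N) (2 * N - 2 * j)) (N - r) * U (2 * mu * real (2 * N - 2 * j))))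
         + (\<Sum>j\<le>N-1. (- (?K * (real ((N-1) choose j) * (-1) ^ (N-1-j)))) *
             (coeff (krawtchouk_gf (2 * N) (2 * N - 2 * j - 1)) (N - r) * U (2 * mu * real (2 * N - 2 * j - 1)))))"
        unfolding U_def
        by (rule level_solution[OF mu xi N er init p0 pk above]) (use r t in auto)
      also have "(\<Sum>l\<le>N. (1 / 4 ^ N * (real (N choose l) * (-1) ^ l)) *
           (coeff (krawtchouk_gf (2 * N) (2 * l)) (N - r) * (1 - theta2 xi t (2 * mu * real (2 * l)))))
        = 1 / 4 ^ N * ?C * (\<Sum>l=0..N. real (N choose l) * (-1) ^ l * theta1 N r (2*l) 0 0 *
               (1 - theta2 xi t (4 * real l * mu)))"
        unfolding sum_distrib_left atLeast0AtMost
      proof (rule sum.cong[OF refl])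
        fix l assume "l \<in> {..N}"
        then have "coeff (krawtchouk_gf (2 * N) (2 * l)) (N - r) = ?C * theta1 N r (2*l) 0 0"
          using theta1_krawtchouk_00[of r N "2 * l"] r by simp
        moreover have "2 * mu * real (2 * l) = 4 * real l * mu" by simp
        ultimately show "(1 / 4 ^ N * (real (N choose l) * (-1) ^ l)) *
           (coeff (krawtchouk_gf (2 * N) (2 * l)) (N - r) * (1 - theta2 xi t (2 * mu * real (2 * l))))
          = 1 / 4 ^ N * ?C * (real (N choose l) * (-1) ^ l * theta1 N r (2*l) 0 0 *
               (1 - theta2 xi t (4 * real l * mu)))"
          by (simp only: mult_ac)
      qed
      also have "(\<Sum>j\<le>N-1. (?K * (real ((N-1) choose j) * (-1) ^ (N-1-j))) *
             (coeff (krawtchouk_gf (2 * N) (2 * N - 2 * j)) (N - r) * U (2 * mu * real (2 * N - 2 * j))))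
        = ?K * (-1) ^ (N-r) * ?C * (\<Sum>j=0..N-1. real ((N-1) choose j) * (-1) ^ (N-1-j) * theta1 N r (2*j) 0 0 *
               U (4 * mu * (real N - real j)))"
        unfolding sum_distrib_left atLeast0AtMost
      proof (rule sum.cong[OF refl])
        fix j assume "j \<in> {..N-1}"
        then have j: "j \<le> N" by simp
        have "coeff (krawtchouk_gf (2 * N) (2 * N - 2 * j)) (N - r) = (-1) ^ (N - r) * (?C * theta1 N r (2 * j) 0 0)"
          using r j by (intro krawtchouk_even_theta1) auto
        moreover have "2 * mu * real (2 * N - 2 * j) = 4 * mu * (real N - real j)"
          using j by (simp add: of_nat_diff algebra_simps)
        ultimately show "(?K * (real ((N-1) choose j) * (-1) ^ (N-1-j))) *
             (coeff (krawtchouk_gf (2 * N) (2 * N - 2 * j)) (N - r) * U (2 * mu * real (2 * N - 2 * j)))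
          = ?K * (-1) ^ (N-r) * ?C * (real ((N-1) choose j) * (-1) ^ (N-1-j) * theta1 N r (2*j) 0 0 *
               U (4 * mu * (real N - real j)))"
          by (simp only: mult_ac)
      qed
      also have "(\<Sum>j\<le>N-1. (- (?K * (real ((N-1) choose j) * (-1) ^ (N-1-j)))) *
             (coeff (krawtchouk_gf (2 * N) (2 * N - 2 * j - 1)) (N - r) * U (2 * mu * real (2 * N - 2 * j - 1))))
        = ?K * (-1) ^ (N-r) * (\<Sum>j=0..N-1. real ((N-1) choose j) * (-1) ^ (N-1-j) * ?D j *
               U (2 * mu * (2 * real N - 2 * real j - 1)))"
        unfolding sum_distrib_left atLeast0AtMost
      proof (rule sum.cong[OF refl])
        fix j assume j: "j \<in> {..N-1}"
        have D: "- coeff (krawtchouk_gf (2 * N) (2 * N - 2 * j - 1)) (N - r) = (-1) ^ (N - r) * ?D j"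
          using r j by (intro krawtchouk_odd_theta1) auto
        have "2 * j + 1 \<le> 2 * N" using j N by auto
        then have "real (2 * N - 2 * j - 1) = 2 * real N - 2 * real j - 1" by (simp add: of_nat_diff)
        \<comment> \<open>The sign moves from the weight to the coefficient, where \<open>D\<close>
          can replace the negated coefficient as a whole.\<close>
        moreover have "(- (?K * (real ((N-1) choose j) * (-1) ^ (N-1-j)))) *
             (coeff (krawtchouk_gf (2 * N) (2 * N - 2 * j - 1)) (N - r) * u)
          = ?K * (real ((N-1) choose j) * (-1) ^ (N-1-j)) *
             (- coeff (krawtchouk_gf (2 * N) (2 * N - 2 * j - 1)) (N - r) * u)" for u
          by simp
        ultimately show "(- (?K * (real ((N-1) choose j) * (-1) ^ (N-1-j)))) *
             (coeff (krawtchouk_gf (2 * N) (2 * N - 2 * j - 1)) (N - r) * U (2 * mu * real (2 * N - 2 * j - 1)))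
          = ?K * (-1) ^ (N-r) * (real ((N-1) choose j) * (-1) ^ (N-1-j) * ?D j *
               U (2 * mu * (2 * real N - 2 * real j - 1)))"
          unfolding D by (simp only: mult_ac)
      qed
      finally show "p_level M X d l0 r t =
          1 / 4 ^ N * ?C *
            (\<Sum>l=0..N. real (N choose l) * (-1) ^ l * theta1 N r (2*l) 0 0 *
               (1 - theta2 xi t (4 * real l * mu)))
          + ?K * (-1) ^ (N-r) *
            (\<Sum>j=0..N-1. real ((N-1) choose j) * (-1) ^ (N-1-j) * ?D j *
               U (2 * mu * (2 * real N - 2 * real j - 1)))
          + ?K * (-1) ^ (N-r) * ?C *
            (\<Sum>j=0..N-1. real ((N-1) choose j) * (-1) ^ (N-1-j) * theta1 N r (2*j) 0 0 *
               U (4 * mu * (real N - real j)))"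
        by linarith
    qed (rule zero)
  qed
qed

end
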